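(* Let $\gamma(t)=(t,\gamma_2(t),\gamma_3(t))$ with $\gamma_2,\gamma_3\in C^\infty(\mathbb{R})$, and suppose that for all $t\in I=[0,1]$ one has $\gamma_2''(t)\neq 0$ and $$\det\begin{pmatrix}\gamma_2''(t)&\gamma_3''(t)\\ \gamma_2'''(t)&\gamma_3'''(t)\end{pmatrix}=\tfrac12(\gamma_2''(t))^2 .$$ Let $Af(x)=\int f(\gamma(t)^{-1}\odot x)\,d\mu(t)$, where $\mu\ne0$. Let $1<p<\infty$ and $s\in\mathbb{R}$. If $A$ maps $L^p_{comp}(\mathbb{R}^3)$ boundedly to $L^p_s(\mathbb{R}^3)$, then $$s\le\min\Big\{\tfrac1p,\ \tfrac12\big(1-\tfrac1p\big)\Big\}.$$
   Context: The Heisenberg group $\mathbb{H}^1$ is $\mathbb{R}^3$ with product $(x_1,x_2,x_3)\odot(w_1,w_2,w_3)=(x_1+w_1,\,x_2+w_2,\,x_3+w_3+\tfrac12(x_1w_2-x_2w_1))$; the inverse is $w^{-1}=-w$. $\mu$ is a smooth measure supported on $\gamma([0,1])$: in the parameter $t$, $d\mu(t)=\eta(t)\,dt$ with $\eta\in C_c^\infty(\mathbb{R})$, $\eta\ge 0$, $\operatorname{supp}\eta\subset[0,1]$. $L^p_s(\mathbb{R}^3)$ is the standard (Euclidean) Sobolev space with norm $\|D^sf\|_{L^p}$, where $\widehat{D^sf}(\xi)=(1+|\xi|^2)^{s/2}\hat f(\xi)$. "$A$ maps $L^p_{comp}$ boundedly to $L^p_s$" means: for every compact $K\subset\mathbb{R}^3$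 there is a constant $C_K$ such that $\|Af\|_{L^p_s(\mathbb{R}^3)}\le C_K\|f\|_{L^p(\mathbb{R}^3)}$ for all $f\in L^p(\mathbb{R}^3)$ supported in $K$. *)

theory Defs
  imports "HOL-Analysis.Analysis"
begin

section \<open>The Heisenberg group\<close>

definition heis_mult :: "real^3 \<Rightarrow> real^3 \<Rightarrow> real^3" (infixl "\<odot>" 70) where
  "x \<odot> w = vector [x$1 + w$1, x$2 + w$2, x$3 + w$3 + (x$1 * w$2 - x$2 * w$1) / 2]"

definition heis_inv :: "real^3 \<Rightarrow> real^3" where
  "heis_inv w = - w"

lemma heis_mult_assoc: "(x \<odot> y) \<odot> z = x \<odot> (y \<odot> z)"
  by (simp add: heis_mult_def vec_eq_iff forall_3 field_simps)

lemma heis_mult_zero: "0 \<odot> w = w" "w \<odot> 0 = w"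
  by (simp_all add: heis_mult_def vec_eq_iff forall_3)

lemma heis_mult_inv: "heis_inv w \<odot> w = 0" "w \<odot> heis_inv w = 0"
  by (simp_all add: heis_mult_def heis_inv_def vec_eq_iff forall_3)

definition heis_average ::
  "(real \<Rightarrow> real^3) \<Rightarrow> real measure \<Rightarrow> (real^3 \<Rightarrow> complex) \<Rightarrow> real^3 \<Rightarrow> complex" where
  "heis_average \<gamma> \<mu> f x = (\<integral>t. f (heis_inv (\<gamma> t) \<odot> x) \<partial>\<mu>)"

section \<open>Smooth functions of one real variable\<close>

definition smooth_real :: "(real \<Rightarrow> real) \<Rightarrow> bool" where
  "smooth_real f \<longleftrightarrow> (\<forall>n t. (deriv ^^ n) f differentiable (at t))"

section \<open>Schwartz functions and tempered distributions\<close>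

fun iter_partial ::
  "'a::euclidean_space list \<Rightarrow> ('a \<Rightarrow> complex) \<Rightarrow> 'a \<Rightarrow> complex" where
  "iter_partial [] f = f"
| "iter_partial (b # bs) f = (\<lambda>x. frechet_derivative (iter_partial bs f) (at x) b)"

definition schwartz :: "('a::euclidean_space \<Rightarrow> complex) set" where
  "schwartz = {\<phi>. \<forall>bs. set bs \<subseteq> Basis \<longrightarrow>
     (\<forall>x. iter_partial bs \<phi> differentiable (at x)) \<and>
     (\<forall>N::nat. bounded (range (\<lambda>x. (1 + norm x) ^ N *\<^sub>R iter_partial bs \<phi> x)))}"

definition schwartz_norm :: "nat \<Rightarrow> ('a::euclidean_space \<Rightarrow> complex) \<Rightarrow> real" where
  "schwartz_norm N \<phi> =
     (SUP (bs, x) \<in> {bs. set bs \<subseteq> Basis \<and> length bs \<le> N} \<times> UNIV.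
        (1 + norm x) ^ N * norm (iter_partial bs \<phi> x))"

text \<open>
  A distribution is a functional on all functions of which only the values on Schwartz
  functions are meaningful; equality of distributions is therefore equality on
  \<^const>\<open>schwartz\<close>.
\<close>

type_synonym 'a distribution = "('a \<Rightarrow> complex) \<Rightarrow> complex"

definition tempered :: "'a::euclidean_space distribution \<Rightarrow> bool" where
  "tempered T \<longleftrightarrow>
     (\<forall>\<phi>\<in>schwartz. \<forall>\<psi>\<in>schwartz. \<forall>a b. T (\<lambda>x. a * \<phi> x + b * \<psi> x) = a * T \<phi> + b * T \<psi>) \<and>
     (\<exists>N C. \<forall>\<phi>\<in>schwartz. norm (T \<phi>) \<le> C * schwartz_norm N \<phi>)"

definition regular_distr :: "('a::euclidean_space \<Rightarrow> complex) \<Rightarrow> 'a distribution" where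
  "regular_distr f = (\<lambda>\<phi>. \<integral>x. f x * \<phi> x \<partial>lborel)"

definition fourier :: "('a::euclidean_space \<Rightarrow> complex) \<Rightarrow> 'a \<Rightarrow> complex" where
  "fourier f \<xi> = (\<integral>x. cis (- (\<xi> \<bullet> x)) * f x \<partial>lborel)"

definition fourier_distr :: "'a::euclidean_space distribution \<Rightarrow> 'a distribution" where
  "fourier_distr T = (\<lambda>\<phi>. T (fourier \<phi>))"

definition mult_distr ::
  "('a::euclidean_space \<Rightarrow> complex) \<Rightarrow> 'a distribution \<Rightarrow> 'a distribution" where
  "mult_distr m T = (\<lambda>\<phi>. T (\<lambda>x. m x * \<phi> x))"

section \<open>Lebesgue and Sobolev spaces\<close>

text \<open>
  Elements of the Lebesgue spaces are represented by Borel functions; the norm does not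
  distinguish functions that agree almost everywhere.
\<close>

definition Lp_space :: "real \<Rightarrow> ('a::euclidean_space \<Rightarrow> complex) set" where
  "Lp_space p = {f \<in> borel_measurable lborel. integrable lborel (\<lambda>x. norm (f x) powr p)}"

definition Lp_norm :: "real \<Rightarrow> ('a::euclidean_space \<Rightarrow> complex) \<Rightarrow> real" where
  "Lp_norm p f = (\<integral>x. norm (f x) powr p \<partial>lborel) powr (1 / p)"

definition bessel_symbol :: "real \<Rightarrow> 'a::euclidean_space \<Rightarrow> complex" where
  "bessel_symbol s \<xi> = of_real ((1 + (norm \<xi>)\<^sup>2) powr (s / 2))"

text \<open>
  \<open>is_bessel_deriv s T g\<close> says that the distribution \<open>D\<^sup>s T\<close>, whose Fourier transform is
  \<open>bessel_symbol s\<close> times that of \<open>T\<close>, is the function \<open>g\<close>.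
\<close>

definition is_bessel_deriv ::
  "real \<Rightarrow> 'a::euclidean_space distribution \<Rightarrow> ('a \<Rightarrow> complex) \<Rightarrow> bool" where
  "is_bessel_deriv s T g \<longleftrightarrow>
     (\<forall>\<phi>\<in>schwartz. fourier_distr (regular_distr g) \<phi>
                     = mult_distr (bessel_symbol s) (fourier_distr T) \<phi>)"

definition sobolev_space :: "real \<Rightarrow> real \<Rightarrow> 'a::euclidean_space distribution set" where
  "sobolev_space p s = {T. tempered T \<and> (\<exists>g\<in>Lp_space p. is_bessel_deriv s T g)}"

text \<open>The function \<open>g\<close> chosen here is unique up to a null set.\<close>

definition sobolev_norm :: "real \<Rightarrow> real \<Rightarrow> 'a::euclidean_space distribution \<Rightarrow> real" where
  "sobolev_norm p s T = Lp_norm p (SOME g. g \<in> Lp_space p \<and> is_bessel_deriv s T g)"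

definition bounded_Lp_comp_to_sobolev ::
  "real \<Rightarrow> real \<Rightarrow> (('a::euclidean_space \<Rightarrow> complex) \<Rightarrow> 'a \<Rightarrow> complex) \<Rightarrow> bool" where
  "bounded_Lp_comp_to_sobolev p s A \<longleftrightarrow>
     (\<forall>K. compact K \<longrightarrow>
        (\<exists>C. \<forall>f\<in>Lp_space p. (AE x in lborel. x \<notin> K \<longrightarrow> f x = 0) \<longrightarrow>
           regular_distr (A f) \<in> sobolev_space p s \<and>
           sobolev_norm p s (regular_distr (A f)) \<le> C * Lp_norm p f))"

end

theory Submission
  imports Defs "HOL-Probability.Characteristic_Functions"
begin

text \<open>
  Both conditions follow by testing the Sobolev bound on indicator functions.  Functions without
  oscillation suffice because for \<open>s > 0\<close> the operator \<open>D\<^sup>-\<^sup>s\<close> is positive: up to a constant,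
  \<open>(1 + |\<xi>|\<^sup>2) powr (-s/2)\<close> is the integral of \<open>r powr (s/2 - 1) exp (-r (1 + |\<xi>|\<^sup>2))\<close> over
  \<open>r > 0\<close>, so \<open>D\<^sup>-\<^sup>s\<close> is an average of heat operators.  If \<open>g = D\<^sup>s (A f)\<close>, this
  gives a pointwise inequality (\<open>bessel_deriv_heat_bound\<close>): the heat flow of \<open>A f\<close> at a small
  time \<open>\<epsilon>\<close> is at most a constant times the integral over \<open>r > 0\<close> of
  \<open>r powr (s/2 - 1) exp (-r)\<close> times the heat flow of \<open>|g|\<close> at time \<open>r + \<epsilon>\<close>.

  Now take \<open>f\<close> to be the indicator of \<open>F\<close>, suppose that \<open>A f \<ge> \<alpha>\<close> near a set \<open>E\<close>, and integrate
  over \<open>E\<close>.  If the heat flow of the indicator of \<open>E\<close> at time \<open>r\<close> is at most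
  \<open>C\<^sub>0 (\<kappa>/r) powr b\<close>, as happens for \<open>b = m/2\<close> if \<open>E\<close> has thickness about \<open>\<surd>\<kappa>\<close> in \<open>m\<close> directions, then
  Hoelder's inequality and the bound for \<open>g\<close> give, for \<open>b < p s / 2\<close>,
  \<open>\<alpha> |E| \<le> C |F| powr (1/p) |E| powr (1 - 1/p) \<kappa> powr (b/p)\<close>
  (\<open>heat_test_bound\<close>).  For families of sets whose measures are powers of a scale \<open>\<delta>\<close>, letting
  \<open>\<delta>\<close> tend to 0 turns this into a linear inequality between exponents (\<open>test_family_exponents\<close>).

  For \<open>s \<le> 1/p\<close>, let \<open>E\<close> be a cube of side \<open>2 \<delta>\<close> and \<open>F\<close> a \<open>\<delta>\<close>-neighbourhood of the curve
  \<open>\<gamma>(t)\<^sup>-\<^sup>1\<close> containing all translates \<open>\<gamma>(t)\<^sup>-\<^sup>1 \<odot> E\<close>.  Then \<open>A f\<close> is bounded below on \<open>E\<close>,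
  \<open>|E| \<sim> \<delta>\<^sup>3\<close>, \<open>|F| \<sim> \<delta>\<^sup>2\<close> and \<open>\<kappa> = \<delta>\<^sup>2\<close>, so that \<open>2 + 2 b \<le> 3\<close> for every \<open>b \<le> 3/2\<close> below
  \<open>p s / 2\<close>; hence \<open>p s \<le> 1\<close>.

  For \<open>s \<le> (1 - 1/p)/2\<close> the determinant condition enters.  It says that
  \<open>\<gamma>\<^sub>3''/\<gamma>\<^sub>2'' - t/2\<close> has derivative 0, whence
  \<open>\<gamma>\<^sub>3' = (t/2 + c) \<gamma>\<^sub>2' - \<gamma>\<^sub>2/2 + c'\<close> (\<open>contact_constants\<close>).  This means that all the
  curves \<open>t \<mapsto> \<gamma>(t)\<^sup>-\<^sup>1 \<odot> x\<close> are tangent to one plane field, the kernel of the contact form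
  \<open>dy\<^sub>3 + (y\<^sub>1/2 - c) dy\<^sub>2 - (y\<^sub>2/2 + c') dy\<^sub>1\<close>, which is horizontal at \<open>(2 c, -2 c', 0)\<close>.  A curve
  through a box \<open>F\<close> with sides \<open>\<delta>, \<delta>, \<delta>\<^sup>2\<close> centred there therefore stays in (a multiple of) it
  for a time of order \<open>\<delta>\<close>.  So \<open>A f\<close> is at least of order \<open>\<delta>\<close> on a tube \<open>E\<close> with dimensions
  \<open>1, \<delta>, \<delta>\<^sup>2\<close> whose vertical sections have length \<open>2 \<delta>\<^sup>2\<close>, and \<open>\<kappa> = \<delta>\<^sup>4\<close>,
  \<open>b \<le> 1/2\<close> are admissible: \<open>4 + 4 b \<le> p + 3\<close>.  Since \<open>p s \<le> 1\<close>, every \<open>b\<close> below \<open>p s / 2\<close> satisfies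
  \<open>b \<le> 1/2\<close>, and \<open>2 p s \<le> p - 1\<close> follows.
\<close>

section \<open>The Gaussian and its Fourier transform\<close>

text \<open>
  The heat kernel at time \<open>r\<close>, multiplied by \<open>(2 \<pi>) ^ DIM('a)\<close>: in this normalization it is the
  Fourier transform of \<open>\<xi> \<mapsto> exp (- r |\<xi>|\<^sup>2)\<close>.
\<close>

definition gauss_kernel :: "real \<Rightarrow> 'a::euclidean_space \<Rightarrow> real" where
  "gauss_kernel r z = sqrt (pi / r) ^ DIM('a) * exp (- (norm z)\<^sup>2 / (4 * r))"

text \<open>
  The characteristic function of the standard normal distribution, rescaled.
\<close>

lemma gaussian_fourier_real:
  fixes z \<epsilon> :: real
  assumes "\<epsilon> > 0"
  shows "has_bochner_integral lborel (\<lambda>\<xi>. cis (- (\<xi> * z)) * of_real (exp (- \<epsilon> * \<xi>\<^sup>2)))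
           (of_real (sqrt (pi / \<epsilon>) * exp (- z\<^sup>2 / (4 * \<epsilon>))))"
proof -
  define t where "t = - z / sqrt (2 * \<epsilon>)"
  have int: "integrable lborel (\<lambda>x. std_normal_density x *\<^sub>R iexp (t * x))"
  proof -
    have i: "integrable lborel (\<lambda>x. std_normal_density x)"
      by simp
    show ?thesis
      by (rule Bochner_Integration.integrable_bound[OF i]) auto
  qed
  have "(\<integral>x. std_normal_density x *\<^sub>R iexp (t * x) \<partial>lborel) = char std_normal_distribution t"
    unfolding char_def by (subst integral_density) auto
  also have "\<dots> = of_real (exp (- t\<^sup>2 / 2))"
    by (simp add: char_std_normal_distribution)
  finally have "has_bochner_integral lborel (\<lambda>x. std_normal_density x *\<^sub>R iexp (t * x)) (of_real (exp (- t\<^sup>2 / 2)))"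
    using int by (simp add: has_bochner_integral_iff)
  then have "has_bochner_integral lborel
     (\<lambda>x. std_normal_density (0 + sqrt (2*\<epsilon>) * x) *\<^sub>R iexp (t * (0 + sqrt (2*\<epsilon>) * x)))
     (of_real (exp (- t\<^sup>2 / 2)) /\<^sub>R \<bar>sqrt (2*\<epsilon>)\<bar>)"
    using assms by (subst (asm) lborel_has_bochner_integral_real_affine_iff[where c="sqrt (2*\<epsilon>)" and t=0]) auto
  then have "has_bochner_integral lborel
     (\<lambda>x. of_real (sqrt (2*pi)) * (std_normal_density (0 + sqrt (2*\<epsilon>) * x) *\<^sub>R iexp (t * (0 + sqrt (2*\<epsilon>) * x))))
     (of_real (sqrt (2*pi)) * (of_real (exp (- t\<^sup>2 / 2)) /\<^sub>R \<bar>sqrt (2*\<epsilon>)\<bar>))"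
    by (rule has_bochner_integral_mult_right)
  moreover have "of_real (sqrt (2*pi)) * (of_real (exp (- t\<^sup>2 / 2)) /\<^sub>R \<bar>sqrt (2*\<epsilon>)\<bar>)
      = complex_of_real (sqrt (pi / \<epsilon>) * exp (- z\<^sup>2 / (4 * \<epsilon>)))"
  proof -
    have "t\<^sup>2 / 2 = z\<^sup>2 / (4 * \<epsilon>)"
      using assms by (simp add: t_def power_divide)
    moreover have "sqrt (2*pi) / sqrt (2*\<epsilon>) = sqrt (pi / \<epsilon>)"
      by (simp flip: real_sqrt_divide)
    ultimately show ?thesis
      using assms by (simp add: scaleR_conv_of_real field_simps flip: of_real_mult of_real_divide)
  qed
  moreover have "(\<lambda>x. of_real (sqrt (2*pi)) * (std_normal_density (0 + sqrt (2*\<epsilon>) * x) *\<^sub>R iexp (t * (0 + sqrt (2*\<epsilon>) * x))))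
     = (\<lambda>\<xi>. cis (- (\<xi> * z)) * complex_of_real (exp (- \<epsilon> * \<xi>\<^sup>2)))"
  proof
    fix x
    have "iexp (t * (0 + sqrt (2*\<epsilon>) * x)) = cis (- (x * z))"
      using assms by (simp add: t_def cis_conv_exp field_simps)
    moreover have "sqrt (2*pi) * std_normal_density (0 + sqrt (2*\<epsilon>) * x) = exp (- \<epsilon> * x\<^sup>2)"
      using assms by (simp add: std_normal_density_def power_mult_distrib)
    ultimately show "of_real (sqrt (2*pi)) * (std_normal_density (0 + sqrt (2*\<epsilon>) * x) *\<^sub>R iexp (t * (0 + sqrt (2*\<epsilon>) * x)))
     = cis (- (x * z)) * complex_of_real (exp (- \<epsilon> * x\<^sup>2))"
      by (simp add: scaleR_conv_of_real flip: mult.assoc of_real_mult)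
  qed
  ultimately show ?thesis by simp
qed

lemma has_bochner_integral_lborel_prod:
  fixes f :: "'a::euclidean_space \<Rightarrow> real \<Rightarrow> complex"
  assumes "\<And>b. b \<in> Basis \<Longrightarrow> has_bochner_integral lborel (f b) (c b)"
  shows "has_bochner_integral lborel (\<lambda>x. \<Prod>b\<in>Basis. f b (x \<bullet> b)) (\<Prod>b\<in>Basis. c b)"
proof -
  interpret product_sigma_finite "\<lambda>b::'a. lborel :: real measure" ..
  have *: "has_bochner_integral (\<Pi>\<^sub>M b\<in>Basis. lborel) (\<lambda>x. \<Prod>b\<in>Basis. f b (x b)) (\<Prod>b\<in>Basis. c b)"
    using assms by (auto simp: has_bochner_integral_iff product_integral_prod intro!: product_integrable_prod prod.cong)
  have [measurable]: "f b \<in> borel_measurable borel" if "b \<in> Basis" for b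
    using assms[OF that] by (auto simp: has_bochner_integral_iff)
  show ?thesis
    by (subst lborel_eq, subst has_bochner_integral_distr)
       (use * in \<open>auto simp: cong: has_bochner_integral_cong\<close>)
qed

lemma gaussian_fourier:
  fixes z :: "'a::euclidean_space"
  assumes "\<epsilon> > 0"
  shows "has_bochner_integral lborel (\<lambda>\<xi>. cis (- (\<xi> \<bullet> z)) * of_real (exp (- \<epsilon> * (norm \<xi>)\<^sup>2)))
           (of_real (gauss_kernel \<epsilon> z))"
proof -
  have "has_bochner_integral lborel
      (\<lambda>\<xi>. \<Prod>b\<in>Basis. cis (- ((\<xi> \<bullet> b) * (z \<bullet> b))) * of_real (exp (- \<epsilon> * (\<xi> \<bullet> b)\<^sup>2)))
      (\<Prod>b\<in>(Basis::'a set). of_real (sqrt (pi / \<epsilon>) * exp (- (z \<bullet> b)\<^sup>2 / (4 * \<epsilon>))))"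
    by (rule has_bochner_integral_lborel_prod) (rule gaussian_fourier_real[OF assms])
  moreover have "(\<Prod>b\<in>Basis. cis (- ((\<xi> \<bullet> b) * (z \<bullet> b))) * of_real (exp (- \<epsilon> * (\<xi> \<bullet> b)\<^sup>2)))
      = cis (- (\<xi> \<bullet> z)) * of_real (exp (- \<epsilon> * (norm \<xi>)\<^sup>2))" for \<xi> :: 'a
  proof -
    have "(\<Prod>b\<in>Basis. cis (- ((\<xi> \<bullet> b) * (z \<bullet> b)))) = cis (- (\<xi> \<bullet> z))"
      unfolding cis_conv_exp
      by (subst exp_sum[symmetric], simp)
        (simp add: euclidean_inner[of \<xi> z] sum_negf sum_distrib_left)
    moreover have "(\<Prod>b\<in>Basis. exp (- \<epsilon> * (\<xi> \<bullet> b)\<^sup>2)) = exp (- \<epsilon> * (norm \<xi>)\<^sup>2)"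
      unfolding power2_norm_eq_inner
      by (subst exp_sum[symmetric], simp)
        (simp add: euclidean_inner[of \<xi> \<xi>] sum_negf sum_distrib_left power2_eq_square)
    ultimately show ?thesis
      by (simp add: prod.distrib flip: of_real_prod)
  qed
  moreover have "(\<Prod>b\<in>(Basis::'a set). complex_of_real (sqrt (pi / \<epsilon>) * exp (- (z \<bullet> b)\<^sup>2 / (4 * \<epsilon>)))) = of_real (gauss_kernel \<epsilon> z)"
  proof -
    have "(\<Prod>b\<in>Basis. exp (- (z \<bullet> b)\<^sup>2 / (4 * \<epsilon>))) = exp (- (norm z)\<^sup>2 / (4 * \<epsilon>))"
      unfolding power2_norm_eq_inner
      by (subst exp_sum[symmetric], simp)
        (simp add: euclidean_inner[of z z] sum_negf sum_divide_distrib power2_eq_square)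
    then show ?thesis
      by (simp add: gauss_kernel_def prod.distrib flip: of_real_prod)
  qed
  ultimately show ?thesis by simp
qed

lemma gauss_kernel_nonneg [simp]: "r \<ge> 0 \<Longrightarrow> 0 \<le> gauss_kernel r z"
  by (simp add: gauss_kernel_def)

lemma gauss_kernel_measurable [measurable]:
  "(\<lambda>(r, z). gauss_kernel r z) \<in> borel_measurable (borel \<Otimes>\<^sub>M borel)"
  unfolding gauss_kernel_def by measurable

lemma gauss_kernel_commute: "gauss_kernel r (x - y) = gauss_kernel r (y - x)"
  by (simp add: gauss_kernel_def norm_minus_commute)

lemma nn_integral_gauss_kernel:
  fixes y :: "'a::euclidean_space"
  assumes "r > 0"
  shows "(\<integral>\<^sup>+x. gauss_kernel r (x - y) \<partial>lborel) = (2 * pi) ^ DIM('a)"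
proof -
  define e where "e = 1 / (4 * r)"
  have e: "e > 0" using assms by (simp add: e_def)
  have "has_bochner_integral lborel (\<lambda>\<xi>::'a. complex_of_real (exp (- e * (norm \<xi>)\<^sup>2))) (of_real (sqrt (pi / e) ^ DIM('a)))"
    using gaussian_fourier[OF e, of "0::'a"] by (simp add: gauss_kernel_def)
  then have 1: "has_bochner_integral lborel (\<lambda>\<xi>::'a. exp (- e * (norm \<xi>)\<^sup>2)) (sqrt (pi / e) ^ DIM('a))"
    using has_bochner_integral_Re by force
  have "(\<integral>\<^sup>+x. gauss_kernel r (x - y) \<partial>lborel) = (\<integral>\<^sup>+x. gauss_kernel r (- y + x) \<partial>lborel)"
    by simp
  also have "\<dots> = (\<integral>\<^sup>+x. gauss_kernel r (x::'a) \<partial>distr lborel borel ((+) (- y)))"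
    by (subst nn_integral_distr) auto
  also have "\<dots> = (\<integral>\<^sup>+x. gauss_kernel r (x::'a) \<partial>lborel)"
    by (simp add: lborel_distr_plus)
  also have "\<dots> = ennreal (\<integral>x. gauss_kernel r (x::'a) \<partial>lborel)"
  proof (rule nn_integral_eq_integral)
    show "integrable lborel (\<lambda>x::'a. gauss_kernel r x)"
      using 1 by (simp add: gauss_kernel_def e_def has_bochner_integral_iff)
  qed (use assms in auto)
  also have "(\<integral>x. gauss_kernel r (x::'a) \<partial>lborel) = sqrt (pi / r) ^ DIM('a) * sqrt (pi / e) ^ DIM('a)"
    using 1 by (simp add: gauss_kernel_def e_def has_bochner_integral_iff)
  also have "\<dots> = (sqrt ((2 * pi)\<^sup>2)) ^ DIM('a)"
    using assms unfolding power_mult_distrib[symmetric] real_sqrt_mult[symmetric]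
    by (simp add: e_def power2_eq_square mult_ac)
  also have "sqrt ((2 * pi)\<^sup>2) = 2 * pi"
    by (simp only: real_sqrt_abs) simp
  finally show ?thesis by simp
qed

lemma gauss_kernel_le:
  fixes z :: "'a::euclidean_space"
  assumes "r > 0"
  shows "gauss_kernel r z \<le> sqrt (pi / r) ^ DIM('a)"
  using assms by (simp add: gauss_kernel_def mult_left_le)

lemma nn_integral_gauss_kernel_le:
  fixes x :: "'a::euclidean_space"
  assumes "r > 0"
  shows "(\<integral>\<^sup>+y\<in>E. gauss_kernel r (x - y) \<partial>lborel) \<le> ennreal ((2 * pi) ^ DIM('a))"
proof -
  have "(\<integral>\<^sup>+y\<in>E. gauss_kernel r (x - y) \<partial>lborel) \<le> (\<integral>\<^sup>+y. gauss_kernel r (y - x) \<partial>lborel)"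
    by (intro nn_integral_mono) (auto simp: gauss_kernel_commute[of r x] indicator_def)
  then show ?thesis by (simp add: nn_integral_gauss_kernel[OF assms])
qed

lemma nn_integral_gauss_kernel_le_emeasure:
  fixes x :: "'a::euclidean_space"
  assumes "r > 0" "E \<in> sets borel"
  shows "(\<integral>\<^sup>+y\<in>E. gauss_kernel r (x - y) \<partial>lborel) \<le> ennreal (sqrt (pi / r) ^ DIM('a)) * emeasure lborel E"
proof -
  have "(\<integral>\<^sup>+y\<in>E. gauss_kernel r (x - y) \<partial>lborel) \<le> (\<integral>\<^sup>+y\<in>E. ennreal (sqrt (pi / r) ^ DIM('a)) \<partial>lborel)"
    by (intro nn_integral_mono mult_right_mono ennreal_leI gauss_kernel_le assms) simp
  then show ?thesis using assms by (simp add: nn_integral_cmult_indicator)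
qed

text \<open>
  On the ball of radius \<open>\<surd>\<epsilon>\<close> the kernel is comparable to its maximum, and the powers of
  \<open>\<epsilon>\<close> cancel. So a lower bound for a function on such a ball survives heat flow up to time \<open>\<epsilon>\<close>,
  with a loss that does not depend on \<open>\<epsilon>\<close>.
\<close>

lemma gauss_kernel_ball_lower_bound:
  fixes y :: "'a::euclidean_space"
  assumes "\<epsilon> > 0"
  shows "ennreal (sqrt pi ^ DIM('a) * exp (- 1 / 4) * unit_ball_vol DIM('a))
     \<le> (\<integral>\<^sup>+x\<in>ball y (sqrt \<epsilon>). gauss_kernel \<epsilon> (x - y) \<partial>lborel)"
proof -
  have "ennreal (sqrt pi ^ DIM('a) * exp (- 1 / 4) * unit_ball_vol DIM('a))
     = ennreal (sqrt (pi / \<epsilon>) ^ DIM('a) * exp (- 1 / 4)) * ennreal (unit_ball_vol DIM('a) * sqrt \<epsilon> ^ DIM('a))"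
    using assms by (simp add: real_sqrt_divide power_divide flip: ennreal_mult)
  also have "\<dots> = (\<integral>\<^sup>+x\<in>ball y (sqrt \<epsilon>). ennreal (sqrt (pi / \<epsilon>) ^ DIM('a) * exp (- 1 / 4)) \<partial>lborel)"
    using assms by (simp add: nn_integral_cmult_indicator emeasure_ball)
  also have "\<dots> \<le> (\<integral>\<^sup>+x\<in>ball y (sqrt \<epsilon>). gauss_kernel \<epsilon> (x - y) \<partial>lborel)"
  proof (rule nn_integral_mono)
    fix x
    show "ennreal (sqrt (pi / \<epsilon>) ^ DIM('a) * exp (- 1 / 4)) * indicator (ball y (sqrt \<epsilon>)) x
      \<le> ennreal (gauss_kernel \<epsilon> (x - y)) * indicator (ball y (sqrt \<epsilon>)) x"
    proof (cases "x \<in> ball y (sqrt \<epsilon>)")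
      case True
      then have "norm (x - y) \<le> sqrt \<epsilon>"
        by (simp add: dist_norm norm_minus_commute)
      then have "(norm (x - y))\<^sup>2 \<le> (sqrt \<epsilon>)\<^sup>2"
        by (rule power_mono) simp
      then have "(norm (x - y))\<^sup>2 / (4 * \<epsilon>) \<le> 1 / 4"
        using assms by (simp add: field_simps)
      then have "sqrt (pi / \<epsilon>) ^ DIM('a) * exp (- 1 / 4) \<le> gauss_kernel \<epsilon> (x - y)"
        unfolding gauss_kernel_def using assms by (intro mult_left_mono) auto
      then show ?thesis by (simp add: mult_right_mono ennreal_leI)
    qed simp
  qed
  finally show ?thesis .
qed

section \<open>Modulated Gaussians as Schwartz functions\<close>

text \<open>
  A class of functions that contains the test functions used below, is visibly closed under partial
  derivatives and decays rapidly. Products with coordinates are needed because they appear when the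
  Gaussian and the power are differentiated.
\<close>

inductive_set modulated_gaussian :: "real \<Rightarrow> 'a::euclidean_space \<Rightarrow> ('a \<Rightarrow> complex) set"
  for \<epsilon> y where
  base: "(\<lambda>\<xi>. of_real ((1 + (norm \<xi>)\<^sup>2) powr a * exp (- \<epsilon> * (norm \<xi>)\<^sup>2)) * cis (\<xi> \<bullet> y))
           \<in> modulated_gaussian \<epsilon> y"
| coord: "f \<in> modulated_gaussian \<epsilon> y \<Longrightarrow> (\<lambda>\<xi>. of_real (\<xi> \<bullet> b) * f \<xi>) \<in> modulated_gaussian \<epsilon> y"
| cmult: "f \<in> modulated_gaussian \<epsilon> y \<Longrightarrow> (\<lambda>\<xi>. c * f \<xi>) \<in> modulated_gaussian \<epsilon> y"
| add: "f \<in> modulated_gaussian \<epsilon> y \<Longrightarrow> g \<in> modulated_gaussian \<epsilon> y \<Longrightarrow>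
           (\<lambda>\<xi>. f \<xi> + g \<xi>) \<in> modulated_gaussian \<epsilon> y"

lemma modulated_gaussian_derivative:
  assumes "f \<in> modulated_gaussian \<epsilon> y"
  shows "\<exists>f'. (\<forall>x. (f has_derivative f' x) (at x)) \<and> (\<forall>b. (\<lambda>x. f' x b) \<in> modulated_gaussian \<epsilon> y)"
  using assms
proof induction
  case (base a)
  define B where "B = (\<lambda>a (\<xi>::'a). of_real ((1 + (norm \<xi>)\<^sup>2) powr a * exp (- \<epsilon> * (norm \<xi>)\<^sup>2)) * cis (\<xi> \<bullet> y))"
  have B: "B a \<in> modulated_gaussian \<epsilon> y" for a
    unfolding B_def by (rule modulated_gaussian.base)
  have nz: "1 + x \<bullet> x > 0" for x :: 'a
    by (simp add: add_pos_nonneg)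
  have "(B a has_derivative (\<lambda>h. of_real (2 * a) * (of_real (x \<bullet> h) * B (a - 1) x)
            + of_real (- 2 * \<epsilon>) * (of_real (x \<bullet> h) * B a x)
            + \<i> * of_real (h \<bullet> y) * B a x)) (at x)" for x
  proof -
    have cis: "((\<lambda>\<xi>. cis (\<xi> \<bullet> y)) has_derivative (\<lambda>h. \<i> * of_real (h \<bullet> y) * cis (x \<bullet> y))) (at x)"
    proof -
      have "((\<lambda>\<xi>. \<i> * complex_of_real (\<xi> \<bullet> y)) has_derivative (\<lambda>h. \<i> * of_real (h \<bullet> y))) (at x)"
        by (rule derivative_eq_intros refl | simp)+
      from has_derivative_compose[OF this DERIV_exp[unfolded has_field_derivative_def]] show ?thesis
        by (simp add: cis_conv_exp mult_ac)
    qed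
    have "((\<lambda>\<xi>. (1 + \<xi> \<bullet> \<xi>) powr a * exp (- \<epsilon> * (\<xi> \<bullet> \<xi>))) has_derivative
       (\<lambda>h. (2 * a * (x \<bullet> h) * (1 + x \<bullet> x) powr (a - 1) - 2 * \<epsilon> * (x \<bullet> h) * (1 + x \<bullet> x) powr a)
          * exp (- \<epsilon> * (x \<bullet> x)))) (at x)"
      apply (rule derivative_eq_intros refl nz | simp)+
      apply (rule ext)
      using nz[of x]
      apply (simp add: powr_diff inner_commute field_simps)
      done
    from has_derivative_mult[OF has_derivative_of_real[OF this] cis]
    show ?thesis
      unfolding B_def power2_norm_eq_inner
      by (rule has_derivative_eq_rhs) (auto simp: fun_eq_iff algebra_simps)
  qed
  moreover have "(\<lambda>x. of_real (2 * a) * (of_real (x \<bullet> h) * B (a - 1) x)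
            + of_real (- 2 * \<epsilon>) * (of_real (x \<bullet> h) * B a x)
            + \<i> * of_real (h \<bullet> y) * B a x) \<in> modulated_gaussian \<epsilon> y" for h
    by (intro modulated_gaussian.add modulated_gaussian.cmult modulated_gaussian.coord B)
  ultimately have "\<exists>f'. (\<forall>x. (B a has_derivative f' x) (at x)) \<and> (\<forall>b. (\<lambda>x. f' x b) \<in> modulated_gaussian \<epsilon> y)"
    by (intro exI[of _ "\<lambda>x h. of_real (2 * a) * (of_real (x \<bullet> h) * B (a - 1) x)
            + of_real (- 2 * \<epsilon>) * (of_real (x \<bullet> h) * B a x)
            + \<i> * of_real (h \<bullet> y) * B a x"]) blast
  then show ?case by (simp add: B_def)
next
  case (coord f b)
  then obtain f' where f': "\<And>x. (f has_derivative f' x) (at x)" "\<And>b. (\<lambda>x. f' x b) \<in> modulated_gaussian \<epsilon> y"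
    by blast
  have "((\<lambda>\<xi>. of_real (\<xi> \<bullet> b) * f \<xi>) has_derivative
      (\<lambda>h. of_real (x \<bullet> b) * f' x h + of_real (h \<bullet> b) * f x)) (at x)" for x
    by (rule derivative_eq_intros f' refl | simp)+
  moreover have "(\<lambda>x. of_real (x \<bullet> b) * f' x h + of_real (h \<bullet> b) * f x) \<in> modulated_gaussian \<epsilon> y" for h
    using coord(1) f'(2) by (intro modulated_gaussian.intros)
  ultimately show ?case
    by (intro exI[of _ "\<lambda>x h. of_real (x \<bullet> b) * f' x h + of_real (h \<bullet> b) * f x"]) blast
next
  case (cmult f c)
  then obtain f' where f': "\<And>x. (f has_derivative f' x) (at x)" "\<And>b. (\<lambda>x. f' x b) \<in> modulated_gaussian \<epsilon> y"
    by blast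
  have "((\<lambda>\<xi>. c * f \<xi>) has_derivative (\<lambda>h. c * f' x h)) (at x)" for x
    by (rule derivative_eq_intros f' refl | simp)+
  moreover have "(\<lambda>x. c * f' x h) \<in> modulated_gaussian \<epsilon> y" for h
    using f'(2) by (intro modulated_gaussian.intros)
  ultimately show ?case
    by (intro exI[of _ "\<lambda>x h. c * f' x h"]) blast
next
  case (add f g)
  then obtain f' g' where f': "\<And>x. (f has_derivative f' x) (at x)" "\<And>b. (\<lambda>x. f' x b) \<in> modulated_gaussian \<epsilon> y"
    and g': "\<And>x. (g has_derivative g' x) (at x)" "\<And>b. (\<lambda>x. g' x b) \<in> modulated_gaussian \<epsilon> y"
    by blast
  have "((\<lambda>\<xi>. f \<xi> + g \<xi>) has_derivative (\<lambda>h. f' x h + g' x h)) (at x)" for x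
    by (rule derivative_eq_intros f' g' refl | simp)+
  moreover have "(\<lambda>x. f' x h + g' x h) \<in> modulated_gaussian \<epsilon> y" for h
    using f'(2) g'(2) by (intro modulated_gaussian.intros)
  ultimately show ?case
    by (intro exI[of _ "\<lambda>x h. f' x h + g' x h"]) blast
qed

lemma power_le_fact_exp:
  fixes x :: real
  assumes "0 \<le> x"
  shows "x ^ n \<le> fact n * exp x"
proof -
  have "(\<Sum>k\<in>{n}. x ^ k /\<^sub>R fact k) \<le> (\<Sum>k. x ^ k /\<^sub>R fact k)"
    by (rule sum_le_suminf) (use assms summable_exp_generic[of x] in auto)
  then have "x ^ n / fact n \<le> exp x"
    by (simp add: exp_def field_simps)
  then show ?thesis by (simp add: field_simps)
qed

text \<open>
  The bound is claimed for every power \<open>N\<close> simultaneously, so that in the induction a factor \<open>\<xi> \<bullet> b\<close>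
  can be absorbed by passing from \<open>N\<close> to \<open>N + 1\<close>.
\<close>

lemma modulated_gaussian_decay:
  assumes "f \<in> modulated_gaussian \<epsilon> y" "\<epsilon> > 0"
  shows "\<exists>C. \<forall>\<xi>. (1 + norm \<xi>) ^ N * norm (f \<xi>) \<le> C"
  using assms(1)
proof (induction arbitrary: N)
  case (base a)
  obtain k :: nat where k: "a \<le> real k"
    using real_arch_simple by blast
  have "(1 + norm \<xi>) ^ N * norm (of_real ((1 + (norm \<xi>)\<^sup>2) powr a * exp (- \<epsilon> * (norm \<xi>)\<^sup>2)) * cis (\<xi> \<bullet> y))
      \<le> fact (N + 2 * k) * exp (1 + 1 / (4 * \<epsilon>))" for \<xi> :: 'a
  proof -
    define t where "t = norm \<xi>"
    have t: "t \<ge> 0" by (simp add: t_def)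
    have "(1 + t\<^sup>2) powr a \<le> (1 + t\<^sup>2) powr k"
      using k by (intro powr_mono) auto
    also have "\<dots> = (1 + t\<^sup>2) ^ k"
      by (simp add: powr_realpow add_pos_nonneg)
    also have "\<dots> \<le> ((1 + t)\<^sup>2) ^ k"
      using t by (intro power_mono) (auto simp: power2_sum)
    also have "\<dots> = (1 + t) ^ (2 * k)"
      by (simp add: power_mult)
    finally have 1: "(1 + t\<^sup>2) powr a \<le> (1 + t) ^ (2 * k)" .
    have "(1 + t) ^ N * ((1 + t\<^sup>2) powr a * exp (- \<epsilon> * t\<^sup>2)) \<le> (1 + t) ^ N * ((1 + t) ^ (2 * k) * exp (- \<epsilon> * t\<^sup>2))"
      using 1 t by (intro mult_left_mono mult_right_mono) auto
    also have "\<dots> = (1 + t) ^ (N + 2 * k) * exp (- \<epsilon> * t\<^sup>2)"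
      by (simp add: power_add)
    also have "\<dots> \<le> fact (N + 2 * k) * exp (1 + t) * exp (- \<epsilon> * t\<^sup>2)"
      using t by (intro mult_right_mono power_le_fact_exp) auto
    also have "\<dots> = fact (N + 2 * k) * exp (1 + t - \<epsilon> * t\<^sup>2)"
      by (simp flip: exp_add)
    also have "1 + t - \<epsilon> * t\<^sup>2 \<le> 1 + 1 / (4 * \<epsilon>)"
    proof -
      have "0 \<le> (2 * \<epsilon> * t - 1)\<^sup>2" by simp
      then show ?thesis using assms(2) by (simp add: field_simps power2_eq_square)
    qed
    finally show ?thesis by (simp add: norm_mult t_def)
  qed
  then show ?case by blast
next
  case (coord f b)
  obtain C where C: "(1 + norm \<xi>) ^ Suc N * norm (f \<xi>) \<le> C" for \<xi>
    using coord.IH[of "Suc N"] by blast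
  have "(1 + norm \<xi>) ^ N * norm (of_real (\<xi> \<bullet> b) * f \<xi>) \<le> norm b * C" for \<xi>
  proof -
    have "\<bar>\<xi> \<bullet> b\<bar> \<le> norm b * (1 + norm \<xi>)"
      using Cauchy_Schwarz_ineq2[of \<xi> b] by (simp add: algebra_simps)
        (meson add_increasing norm_ge_zero)
    then have "(1 + norm \<xi>) ^ N * norm (of_real (\<xi> \<bullet> b) * f \<xi>) \<le> (1 + norm \<xi>) ^ N * ((norm b * (1 + norm \<xi>)) * norm (f \<xi>))"
      by (simp add: norm_mult mult_left_mono mult_right_mono)
    also have "\<dots> = norm b * ((1 + norm \<xi>) ^ Suc N * norm (f \<xi>))" by simp
    also have "\<dots> \<le> norm b * C" using C by (intro mult_left_mono) auto
    finally show ?thesis .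
  qed
  then show ?case by blast
next
  case (cmult f c)
  obtain C where C: "(1 + norm \<xi>) ^ N * norm (f \<xi>) \<le> C" for \<xi>
    using cmult.IH[of "N"] by blast
  have "(1 + norm \<xi>) ^ N * norm (c * f \<xi>) \<le> norm c * C" for \<xi>
    using mult_left_mono[OF C norm_ge_zero[of c]] by (simp add: norm_mult mult_ac)
  then show ?case by blast
next
  case (add f g)
  obtain C D where "(1 + norm \<xi>) ^ N * norm (f \<xi>) \<le> C" "(1 + norm \<xi>) ^ N * norm (g \<xi>) \<le> D" for \<xi>
    using add.IH[of "N"] by blast
  then have "(1 + norm \<xi>) ^ N * norm (f \<xi> + g \<xi>) \<le> C + D" for \<xi>
    by (smt (verit, best) distrib_left mult_left_mono norm_ge_zero norm_triangle_ineq zero_le_power)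
  then show ?case by blast
qed

lemma modulated_gaussian_schwartz:
  assumes "f \<in> modulated_gaussian \<epsilon> y" "\<epsilon> > 0"
  shows "f \<in> schwartz"
proof -
  have it: "iter_partial bs f \<in> modulated_gaussian \<epsilon> y" for bs
  proof (induction bs)
    case (Cons b bs)
    obtain f' where f': "\<And>x. (iter_partial bs f has_derivative f' x) (at x)"
        "\<And>b. (\<lambda>x. f' x b) \<in> modulated_gaussian \<epsilon> y"
      using modulated_gaussian_derivative[OF Cons] by blast
    have "iter_partial (b # bs) f = (\<lambda>x. f' x b)"
      using frechet_derivative_at[OF f'(1)] by simp
    then show ?case using f'(2) by simp
  qed (use assms in auto)
  show ?thesis unfolding schwartz_def
  proof (intro CollectI allI impI conjI)
    fix bs :: "'a list" and x
    show "iter_partial bs f differentiable at x"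
      using modulated_gaussian_derivative[OF it] unfolding differentiable_def by blast
  next
    fix bs :: "'a list" and N
    obtain C where "(1 + norm \<xi>) ^ N * norm (iter_partial bs f \<xi>) \<le> C" for \<xi>
      using modulated_gaussian_decay[OF it assms(2)] by blast
    then show "bounded (range (\<lambda>x. (1 + norm x) ^ N *\<^sub>R iter_partial bs f x))"
      by (intro boundedI[of _ C]) auto
  qed
qed

section \<open>Bessel potentials as averages of the heat flow\<close>

text \<open>
  The density of the heat times in the Bessel potential of order \<open>2 a\<close>, without its normalizing
  constant \<open>1 / Gamma a\<close>.
\<close>

definition gamma_weight :: "real \<Rightarrow> real \<Rightarrow> real" where
  "gamma_weight a r = indicator {0<..} r * (r powr (a - 1) * exp (- r))"

lemma gamma_weight_nonneg [simp]: "0 \<le> gamma_weight a r"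
  by (simp add: gamma_weight_def)

lemma gamma_weight_measurable [measurable]: "gamma_weight a \<in> borel_measurable borel"
  unfolding gamma_weight_def by measurable

text \<open>
  Euler's integral for the Gamma function after the substitution \<open>t = A r\<close>. Read from right to left it
  writes a negative power of \<open>A\<close> as a superposition of exponentials; below \<open>A = 1 + |\<xi>|\<^sup>2\<close>.
\<close>

lemma gamma_weight_integral:
  fixes a A :: real
  assumes "a > 0" "A > 0"
  shows "has_bochner_integral lborel (\<lambda>r. indicator {0<..} r * (r powr (a - 1) * exp (- A * r)))
           (Gamma a * A powr (- a))"
proof (rule has_bochner_integral_nn_integral)
  have "ennreal (Gamma a) = (\<integral>\<^sup>+t. ennreal (indicator {0..} t * t powr (a - 1) / exp t) \<partial>lborel)"
    using Gamma_conv_nn_integral_real[OF assms(1)] .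
  also have "\<dots> = ennreal \<bar>A\<bar> * (\<integral>\<^sup>+r. ennreal (indicator {0..} (0 + A * r) * (0 + A * r) powr (a - 1) / exp (0 + A * r)) \<partial>lborel)"
    by (rule nn_integral_real_affine) (use assms in auto)
  also have "(\<integral>\<^sup>+r. ennreal (indicator {0..} (0 + A * r) * (0 + A * r) powr (a - 1) / exp (0 + A * r)) \<partial>lborel)
     = (\<integral>\<^sup>+r. ennreal (A powr (a - 1)) * ennreal (indicator {0<..} r * (r powr (a - 1) * exp (- A * r))) \<partial>lborel)"
    by (rule nn_integral_cong)
      (use assms in \<open>auto simp: indicator_def zero_le_mult_iff powr_mult exp_minus divide_inverse ennreal_mult[symmetric]\<close>)
  also have "\<dots> = ennreal (A powr (a - 1)) * (\<integral>\<^sup>+r. ennreal (indicator {0<..} r * (r powr (a - 1) * exp (- A * r))) \<partial>lborel)"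
    by (rule nn_integral_cmult) auto
  also have "ennreal \<bar>A\<bar> * (ennreal (A powr (a - 1)) * (\<integral>\<^sup>+r. ennreal (indicator {0<..} r * (r powr (a - 1) * exp (- A * r))) \<partial>lborel))
    = ennreal (A powr a) * (\<integral>\<^sup>+r. ennreal (indicator {0<..} r * (r powr (a - 1) * exp (- A * r))) \<partial>lborel)"
    using assms by (simp add: powr_diff flip: mult.assoc ennreal_mult)
  finally have "ennreal (A powr (- a)) * ennreal (Gamma a) =
      ennreal (A powr (- a)) * (ennreal (A powr a) * (\<integral>\<^sup>+r. ennreal (indicator {0<..} r * (r powr (a - 1) * exp (- A * r))) \<partial>lborel))"
    by simp
  also have "\<dots> = (\<integral>\<^sup>+r. ennreal (indicator {0<..} r * (r powr (a - 1) * exp (- A * r))) \<partial>lborel)"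
    using assms by (simp flip: mult.assoc ennreal_mult powr_add)
  finally show "(\<integral>\<^sup>+r. ennreal (indicator {0<..} r * (r powr (a - 1) * exp (- A * r))) \<partial>lborel)
      = ennreal (Gamma a * A powr (- a))"
    using assms by (simp add: Gamma_real_nonneg mult.commute flip: ennreal_mult)
qed (use assms in \<open>auto simp: indicator_def Gamma_real_nonneg\<close>)

text \<open>
  The function whose pairing with \<open>D\<^sup>s T\<close> is, by design, the pairing of \<open>T\<close> with a Gaussian centred at
  \<open>y\<close>: the Bessel symbol cancels the power.
\<close>

definition bessel_gaussian :: "real \<Rightarrow> real \<Rightarrow> 'a::euclidean_space \<Rightarrow> 'a \<Rightarrow> complex" where
  "bessel_gaussian s \<epsilon> y \<xi> =
     of_real ((1 + (norm \<xi>)\<^sup>2) powr (- s / 2) * exp (- \<epsilon> * (norm \<xi>)\<^sup>2)) * cis (\<xi> \<bullet> y)"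

lemma bessel_gaussian_schwartz:
  assumes "\<epsilon> > 0"
  shows "bessel_gaussian s \<epsilon> y \<in> schwartz"
proof -
  have "bessel_gaussian s \<epsilon> y \<in> modulated_gaussian \<epsilon> y"
    unfolding bessel_gaussian_def[abs_def] by (rule modulated_gaussian.base)
  then show ?thesis using assms by (rule modulated_gaussian_schwartz)
qed

lemma fourier_bessel_symbol_times_bessel_gaussian:
  assumes "\<epsilon> > 0"
  shows "fourier (\<lambda>\<xi>. bessel_symbol s \<xi> * bessel_gaussian s \<epsilon> y \<xi>) x = of_real (gauss_kernel \<epsilon> (x - y))"
proof -
  have "fourier (\<lambda>\<xi>. bessel_symbol s \<xi> * bessel_gaussian s \<epsilon> y \<xi>) x
      = (\<integral>\<xi>. cis (- (\<xi> \<bullet> (x - y))) * of_real (exp (- \<epsilon> * (norm \<xi>)\<^sup>2)) \<partial>lborel)"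
    unfolding fourier_def
  proof (rule Bochner_Integration.integral_cong[OF refl])
    fix \<xi> :: 'a
    have "1 + (norm \<xi>)\<^sup>2 > 0" by (simp add: add_pos_nonneg)
    then have "(1 + (norm \<xi>)\<^sup>2) powr (s / 2) * (1 + (norm \<xi>)\<^sup>2) powr (- s / 2) = 1"
      by (simp flip: powr_add)
    then have "bessel_symbol s \<xi> * bessel_gaussian s \<epsilon> y \<xi> = of_real (exp (- \<epsilon> * (norm \<xi>)\<^sup>2)) * cis (\<xi> \<bullet> y)"
      by (simp add: bessel_symbol_def bessel_gaussian_def flip: mult.assoc of_real_mult)
    then show "cis (- (x \<bullet> \<xi>)) * (bessel_symbol s \<xi> * bessel_gaussian s \<epsilon> y \<xi>)
      = cis (- (\<xi> \<bullet> (x - y))) * of_real (exp (- \<epsilon> * (norm \<xi>)\<^sup>2))"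
      by (simp add: cis_mult inner_diff_right inner_commute mult_ac flip: mult.assoc)
  qed
  also have "\<dots> = of_real (gauss_kernel \<epsilon> (x - y))"
    using gaussian_fourier[OF assms] by (rule has_bochner_integral_integral_eq)
  finally show ?thesis .
qed

text \<open>
  The left-hand side involves \<open>D\<^sup>-\<^sup>s\<close> applied to a Gaussian. Writing the power as a superposition of
  exponentials and exchanging the integrals makes it a superposition of wider Gaussians, all of
  them positive. (In fact equality holds.)
\<close>

lemma fourier_bessel_gaussian_bound:
  fixes x y :: "'a::euclidean_space"
  assumes "s > 0" "\<epsilon> > 0"
  shows "ennreal (Gamma (s / 2) * norm (fourier (bessel_gaussian s \<epsilon> y) x))
     \<le> (\<integral>\<^sup>+r. gamma_weight (s / 2) r * gauss_kernel (r + \<epsilon>) (x - y) \<partial>lborel)"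
proof -
  define F where "F = (\<lambda>r \<xi>. of_real (gamma_weight (s / 2) r) *
     (cis (- (\<xi> \<bullet> (x - y))) * complex_of_real (exp (- (r + \<epsilon>) * (norm \<xi>)\<^sup>2))))"
  have w: "integrable lborel (gamma_weight (s / 2))"
    using gamma_weight_integral[of "s / 2" 1] assms
    by (simp add: gamma_weight_def[abs_def] has_bochner_integral_iff)
  have g: "integrable lborel (\<lambda>\<xi>::'a. complex_of_real (exp (- \<epsilon> * (norm \<xi>)\<^sup>2)))"
    using gaussian_fourier[OF assms(2), of "0::'a"] by (simp add: has_bochner_integral_iff)
  have "integrable (lborel \<Otimes>\<^sub>M lborel) (\<lambda>(r, \<xi>::'a). of_real (gamma_weight (s / 2) r) * complex_of_real (exp (- \<epsilon> * (norm \<xi>)\<^sup>2)))"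
    by (rule lborel_pair.Fubini_integrable) (use w g in \<open>auto simp: norm_mult\<close>)
  then have int: "integrable (lborel \<Otimes>\<^sub>M lborel) (\<lambda>(r, \<xi>). F r \<xi>)"
  proof (rule Bochner_Integration.integrable_bound, goal_cases)
    case 1
    have "continuous_on UNIV (\<lambda>p::real \<times> 'a. cis (- (snd p \<bullet> (x - y))) * complex_of_real (exp (- (fst p + \<epsilon>) * (norm (snd p))\<^sup>2)))"
      by (intro continuous_intros)
    then have "(\<lambda>p::real \<times> 'a. cis (- (snd p \<bullet> (x - y))) * complex_of_real (exp (- (fst p + \<epsilon>) * (norm (snd p))\<^sup>2)))
        \<in> borel_measurable (borel \<Otimes>\<^sub>M borel)"
      unfolding borel_prod by (rule borel_measurable_continuous_onI)
    then have [measurable]: "(\<lambda>p::real \<times> 'a. cis (- (snd p \<bullet> (x - y))) * complex_of_real (exp (- (fst p + \<epsilon>) * (norm (snd p))\<^sup>2)))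
        \<in> borel_measurable (lborel \<Otimes>\<^sub>M lborel)"
      by (simp cong: measurable_cong_sets)
    show ?case unfolding F_def case_prod_beta by measurable
  next
    case 2
    have "gamma_weight (s / 2) r * exp (- (r + \<epsilon>) * (norm \<xi>)\<^sup>2) \<le> gamma_weight (s / 2) r * exp (- \<epsilon> * (norm \<xi>)\<^sup>2)" for r and \<xi> :: 'a
      by (cases "r > 0") (auto simp: gamma_weight_def algebra_simps)
    then show ?case
      by (auto simp: F_def norm_mult)
  qed
  have "Gamma (s / 2) * fourier (bessel_gaussian s \<epsilon> y) x = (\<integral>\<xi>. (\<integral>r. F r \<xi> \<partial>lborel) \<partial>lborel)"
    unfolding fourier_def integral_mult_right_zero[symmetric]
  proof (rule Bochner_Integration.integral_cong[OF refl])
    fix \<xi> :: 'a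
    define A where "A = 1 + (norm \<xi>)\<^sup>2"
    have A: "A > 0" by (simp add: A_def add_pos_nonneg)
    have "(\<integral>r. F r \<xi> \<partial>lborel) = (\<integral>r. (cis (- (\<xi> \<bullet> (x - y))) * of_real (exp (- \<epsilon> * (norm \<xi>)\<^sup>2))) *
         complex_of_real (indicator {0<..} r * (r powr (s / 2 - 1) * exp (- A * r))) \<partial>lborel)"
    proof (rule Bochner_Integration.integral_cong[OF refl])
      fix r
      have "exp (- r) * exp (- (r + \<epsilon>) * (norm \<xi>)\<^sup>2) = exp (- \<epsilon> * (norm \<xi>)\<^sup>2) * exp (- A * r)"
        by (simp add: A_def algebra_simps flip: exp_add)
      then have "gamma_weight (s / 2) r * exp (- (r + \<epsilon>) * (norm \<xi>)\<^sup>2) =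
          exp (- \<epsilon> * (norm \<xi>)\<^sup>2) * (indicator {0<..} r * (r powr (s / 2 - 1) * exp (- A * r)))"
        by (simp add: gamma_weight_def mult_ac)
      then show "F r \<xi> = (cis (- (\<xi> \<bullet> (x - y))) * of_real (exp (- \<epsilon> * (norm \<xi>)\<^sup>2))) *
         complex_of_real (indicator {0<..} r * (r powr (s / 2 - 1) * exp (- A * r)))"
        unfolding F_def
        by (metis (no_types, opaque_lifting) mult.assoc mult.left_commute of_real_mult)
    qed
    also have "\<dots> = (cis (- (\<xi> \<bullet> (x - y))) * of_real (exp (- \<epsilon> * (norm \<xi>)\<^sup>2))) *
        complex_of_real (\<integral>r. indicator {0<..} r * (r powr (s / 2 - 1) * exp (- A * r)) \<partial>lborel)"
      by (simp del: of_real_mult)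
    also have "(\<integral>r. indicator {0<..} r * (r powr (s / 2 - 1) * exp (- A * r)) \<partial>lborel) = Gamma (s / 2) * A powr (- s / 2)"
      using gamma_weight_integral[of "s / 2" A] assms A by (simp add: has_bochner_integral_iff)
    finally show "Gamma (s / 2) * (cis (- (x \<bullet> \<xi>)) * bessel_gaussian s \<epsilon> y \<xi>) = (\<integral>r. F r \<xi> \<partial>lborel)"
      by (simp add: bessel_gaussian_def A_def inner_diff_right inner_commute cis_mult mult_ac
          flip: cis_mult)
        (simp add: cis_mult flip: mult.assoc)
  qed
  also have "\<dots> = (\<integral>r. (\<integral>\<xi>. F r \<xi> \<partial>lborel) \<partial>lborel)"
    using int by (rule lborel_pair.Fubini_integral)
  finally have "ennreal (norm (Gamma (s / 2) * fourier (bessel_gaussian s \<epsilon> y) x))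
      = ennreal (norm (\<integral>r. (\<integral>\<xi>. F r \<xi> \<partial>lborel) \<partial>lborel))" by simp
  also have "\<dots> \<le> (\<integral>\<^sup>+r. norm (\<integral>\<xi>. F r \<xi> \<partial>lborel) \<partial>lborel)"
    using lborel_pair.integrable_fst[OF int] by (intro integral_norm_bound_ennreal) auto
  also have "\<dots> = (\<integral>\<^sup>+r. gamma_weight (s / 2) r * gauss_kernel (r + \<epsilon>) (x - y) \<partial>lborel)"
  proof (rule nn_integral_cong)
    fix r
    show "ennreal (norm (\<integral>\<xi>. F r \<xi> \<partial>lborel)) = ennreal (gamma_weight (s / 2) r * gauss_kernel (r + \<epsilon>) (x - y))"
    proof (cases "r > 0")
      case True
      then show ?thesis
        using has_bochner_integral_integral_eq[OF gaussian_fourier[of "r + \<epsilon>" "x - y"]] assms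
        by (simp add: F_def norm_mult)
    qed (simp add: F_def gamma_weight_def)
  qed
  finally show ?thesis
    using assms by (simp add: norm_mult Gamma_real_nonneg)
qed

lemma norm_integral_le_nn_integral:
  fixes f :: "'a \<Rightarrow> 'b::{banach, second_countable_topology}"
  shows "ennreal (norm (integral\<^sup>L M f)) \<le> (\<integral>\<^sup>+x. norm (f x) \<partial>M)"
proof (cases "integrable M f")
  case False
  then show ?thesis by (simp add: not_integrable_integral_eq)
qed (rule integral_norm_bound_ennreal)

text \<open>
  Duality with \<open>bessel_gaussian s \<epsilon> y\<close>: on the side of \<open>v\<close> its Fourier transform becomes a heat kernel
  at time \<open>\<epsilon>\<close>, on the side of \<open>g\<close> an average of heat kernels at later times. Since all kernels are
  positive, \<open>g\<close> enters only through \<open>|g|\<close>.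
\<close>

lemma bessel_deriv_heat_bound:
  fixes v :: "'a::euclidean_space \<Rightarrow> real"
  assumes s: "s > 0" and \<epsilon>: "\<epsilon> > 0"
    and deriv: "is_bessel_deriv s (regular_distr (\<lambda>x. of_real (v x))) g"
    and [measurable]: "v \<in> borel_measurable borel" "g \<in> borel_measurable borel"
    and v: "\<And>x. 0 \<le> v x" "\<And>x. v x \<le> M"
  shows "ennreal (Gamma (s / 2)) * (\<integral>\<^sup>+x. v x * gauss_kernel \<epsilon> (x - y) \<partial>lborel)
    \<le> (\<integral>\<^sup>+r. gamma_weight (s / 2) r *
          (\<integral>\<^sup>+x. norm (g x) * gauss_kernel (r + \<epsilon>) (x - y) \<partial>lborel) \<partial>lborel)"
proof -
  let ?\<phi> = "bessel_gaussian s \<epsilon> y"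
  have \<Gamma>: "Gamma (s / 2) > 0" using s by (simp add: Gamma_real_pos)
  have "integrable lborel (\<lambda>x::'a. gauss_kernel \<epsilon> (x - y))"
    using nn_integral_gauss_kernel[OF \<epsilon>, of y] \<epsilon>
    by (intro integrableI_nonneg) (auto simp: ennreal_power[symmetric] ennreal_mult_less_top power_mult_distrib)
  then have "integrable lborel (\<lambda>x. M * gauss_kernel \<epsilon> (x - y))"
    by (rule integrable_mult_right)
  then have int: "integrable lborel (\<lambda>x. v x * gauss_kernel \<epsilon> (x - y))"
  proof (rule Bochner_Integration.integrable_bound)
    have "norm (v x * gauss_kernel \<epsilon> (x - y)) \<le> norm (M * gauss_kernel \<epsilon> (x - y))" for x
      unfolding norm_mult using v[of x] by (intro mult_right_mono) auto
    then show "AE x in lborel. norm (v x * gauss_kernel \<epsilon> (x - y)) \<le> norm (M * gauss_kernel \<epsilon> (x - y))"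
      by simp
  qed simp
  have "fourier_distr (regular_distr g) ?\<phi> =
      mult_distr (bessel_symbol s) (fourier_distr (regular_distr (\<lambda>x. of_real (v x)))) ?\<phi>"
    using deriv bessel_gaussian_schwartz[OF \<epsilon>] by (auto simp: is_bessel_deriv_def)
  then have eq: "(\<integral>x. g x * fourier ?\<phi> x \<partial>lborel) = of_real (\<integral>x. v x * gauss_kernel \<epsilon> (x - y) \<partial>lborel)"
    by (simp add: fourier_distr_def regular_distr_def mult_distr_def
          fourier_bessel_symbol_times_bessel_gaussian[OF \<epsilon>] flip: of_real_mult)
  have "(\<integral>\<^sup>+x. v x * gauss_kernel \<epsilon> (x - y) \<partial>lborel) = ennreal (\<integral>x. v x * gauss_kernel \<epsilon> (x - y) \<partial>lborel)"
    using int v \<epsilon> by (intro nn_integral_eq_integral) auto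
  also have "\<dots> = ennreal (norm (\<integral>x. g x * fourier ?\<phi> x \<partial>lborel))"
    using v \<epsilon> unfolding eq norm_of_real by (subst abs_of_nonneg) auto
  also have "\<dots> \<le> (\<integral>\<^sup>+x. norm (g x * fourier ?\<phi> x) \<partial>lborel)"
    by (rule norm_integral_le_nn_integral)
  also have "\<dots> \<le> (\<integral>\<^sup>+x. ennreal (1 / Gamma (s / 2)) * (norm (g x) *
      (\<integral>\<^sup>+r. gamma_weight (s / 2) r * gauss_kernel (r + \<epsilon>) (x - y) \<partial>lborel)) \<partial>lborel)"
  proof (rule nn_integral_mono)
    fix x
    have "ennreal (norm (g x * fourier ?\<phi> x))
        = ennreal (1 / Gamma (s / 2)) * (norm (g x) * ennreal (Gamma (s / 2) * norm (fourier ?\<phi> x)))"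
      using \<Gamma> by (simp add: norm_mult flip: ennreal_mult)
    also have "\<dots> \<le> ennreal (1 / Gamma (s / 2)) * (norm (g x) *
        (\<integral>\<^sup>+r. gamma_weight (s / 2) r * gauss_kernel (r + \<epsilon>) (x - y) \<partial>lborel))"
      by (intro mult_left_mono fourier_bessel_gaussian_bound s \<epsilon>) simp_all
    finally show "ennreal (norm (g x * fourier ?\<phi> x)) \<le> \<dots>" .
  qed
  also have "\<dots> = ennreal (1 / Gamma (s / 2)) *
      (\<integral>\<^sup>+x. norm (g x) * (\<integral>\<^sup>+r. gamma_weight (s / 2) r * gauss_kernel (r + \<epsilon>) (x - y) \<partial>lborel) \<partial>lborel)"
    by (rule nn_integral_cmult) measurable
  finally have "ennreal (Gamma (s / 2)) * (\<integral>\<^sup>+x. v x * gauss_kernel \<epsilon> (x - y) \<partial>lborel)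
     \<le> ennreal (Gamma (s / 2)) * (ennreal (1 / Gamma (s / 2)) *
      (\<integral>\<^sup>+x. norm (g x) * (\<integral>\<^sup>+r. gamma_weight (s / 2) r * gauss_kernel (r + \<epsilon>) (x - y) \<partial>lborel) \<partial>lborel))"
    by (rule mult_left_mono) simp
  also have "\<dots> = (\<integral>\<^sup>+x. norm (g x) * (\<integral>\<^sup>+r. gamma_weight (s / 2) r * gauss_kernel (r + \<epsilon>) (x - y) \<partial>lborel) \<partial>lborel)"
    using \<Gamma> by (simp flip: mult.assoc ennreal_mult)
  also have "\<dots> = (\<integral>\<^sup>+x. (\<integral>\<^sup>+r. norm (g x) * ennreal (gamma_weight (s / 2) r * gauss_kernel (r + \<epsilon>) (x - y)) \<partial>lborel) \<partial>lborel)"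
    by (intro nn_integral_cong nn_integral_cmult[symmetric]) measurable
  also have "\<dots> = (\<integral>\<^sup>+r. (\<integral>\<^sup>+x. norm (g x) * ennreal (gamma_weight (s / 2) r * gauss_kernel (r + \<epsilon>) (x - y)) \<partial>lborel) \<partial>lborel)"
    by (rule lborel_pair.Fubini') measurable
  also have "\<dots> = (\<integral>\<^sup>+r. gamma_weight (s / 2) r *
          (\<integral>\<^sup>+x. norm (g x) * gauss_kernel (r + \<epsilon>) (x - y) \<partial>lborel) \<partial>lborel)"
  proof (rule nn_integral_cong)
    fix r
    show "(\<integral>\<^sup>+x. norm (g x) * ennreal (gamma_weight (s / 2) r * gauss_kernel (r + \<epsilon>) (x - y)) \<partial>lborel)
      = gamma_weight (s / 2) r * (\<integral>\<^sup>+x. norm (g x) * gauss_kernel (r + \<epsilon>) (x - y) \<partial>lborel)"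
      unfolding ennreal_mult'[OF gamma_weight_nonneg] mult.left_commute[of "ennreal (norm _)"]
      by (subst nn_integral_cmult[symmetric]) (auto simp: ennreal_mult')
  qed
  finally show ?thesis .
qed

section \<open>Sobolev bounds tested on sets\<close>

text \<open>
  Hoelder's inequality combined with the interpolation bound
  \<open>\<integral> h powr q \<le> M powr (q - 1) * V\<close> for the conjugate exponent \<open>q\<close>. Both are obtained in one step from
  Young's inequality \<open>f \<le> c f powr p / p + c powr (- q / p) / q\<close>, integrated against \<open>h\<close>, with the value
  of \<open>c\<close> that makes the two terms balance.
\<close>

lemma holder_bounded_weight:
  fixes f :: "'a \<Rightarrow> real" and h :: "'a \<Rightarrow> ennreal"
  assumes p: "p > 1" and pos: "B > 0" "M > 0" "V > 0"
    and [measurable]: "f \<in> borel_measurable N" "h \<in> borel_measurable N"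
    and f: "\<And>x. 0 \<le> f x" "(\<integral>\<^sup>+x. f x powr p \<partial>N) \<le> ennreal (B powr p)"
    and h: "\<And>x. h x \<le> ennreal M" "(\<integral>\<^sup>+x. h x \<partial>N) \<le> ennreal V"
  shows "(\<integral>\<^sup>+x. f x * h x \<partial>N) \<le> ennreal (B * M powr (1 / p) * V powr (1 - 1 / p))"
proof -
  define q where "q = p / (p - 1)"
  have q: "q > 1" "1 / p + 1 / q = 1" "1 / q = 1 - 1 / p"
    using p by (auto simp: q_def field_simps)
  \<comment> \<open>\<open>c\<close> solves \<open>c * X = c powr (- q / p) * V\<close>\<close>
  define X where "X = M * B powr p"
  define c where "c = (V / X) powr (1 / q)"
  have X: "X > 0" using pos by (simp add: X_def)
  have c: "c > 0" using pos X by (simp add: c_def)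
  define d where "d = c powr (- q / p)"
  have d: "d \<ge> 0" by (simp add: d_def)
  have young: "f x \<le> c / p * (f x powr p) + d / q" for x
  proof -
    have "f x = (c powr (1/p) * f x) * c powr (- 1 / p)"
      using c by (simp add: powr_minus field_simps)
    also have "\<dots> \<le> (c powr (1/p) * f x) powr p / p + (c powr (- 1 / p)) powr q / q"
      using p q f by (intro Youngs_inequality) auto
    also have "\<dots> = c / p * (f x powr p) + d / q"
      using p c f by (simp add: powr_mult powr_powr d_def)
    finally show ?thesis .
  qed
  have "(\<integral>\<^sup>+x. f x * h x \<partial>N) \<le> (\<integral>\<^sup>+x. ennreal (c / p * M) * (f x powr p) + ennreal (d / q) * h x \<partial>N)"
  proof (rule nn_integral_mono)
    fix x
    have "ennreal (f x) * h x \<le> ennreal (c / p * (f x powr p) + d / q) * h x"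
      by (intro mult_right_mono ennreal_leI young) simp
    also have "\<dots> = ennreal (c / p) * (f x powr p) * h x + ennreal (d / q) * h x"
    proof -
      have "ennreal (c / p * (f x powr p) + d / q) = ennreal (c / p) * (f x powr p) + ennreal (d / q)"
        using c d p q by (subst ennreal_plus) (auto simp: ennreal_mult[symmetric])
      then show ?thesis by (simp only: distrib_right)
    qed
    also have "\<dots> \<le> ennreal (c / p) * (f x powr p) * ennreal M + ennreal (d / q) * h x"
      by (intro add_right_mono mult_left_mono h) simp
    also have "\<dots> = ennreal (c / p * M) * (f x powr p) + ennreal (d / q) * h x"
    proof -
      have "ennreal (c / p * M) = ennreal (c / p) * ennreal M"
        using c p pos by (intro ennreal_mult) auto
      then show ?thesis by (simp only: mult_ac)
    qed
    finally show "ennreal (f x) * h x \<le> \<dots>" .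
  qed
  also have "\<dots> = ennreal (c / p * M) * (\<integral>\<^sup>+x. f x powr p \<partial>N) + ennreal (d / q) * (\<integral>\<^sup>+x. h x \<partial>N)"
    by (subst nn_integral_add) (auto simp: nn_integral_cmult)
  also have "\<dots> \<le> ennreal (c / p * M) * ennreal (B powr p) + ennreal (d / q) * ennreal V"
    by (intro add_mono mult_left_mono f h) auto
  also have "\<dots> = ennreal (c * X / p + d * V / q)"
    using c d p q pos by (simp add: X_def ennreal_mult[symmetric] ennreal_plus[symmetric] mult_ac del: ennreal_plus)
  also have "c * X / p + d * V / q = X powr (1 / p) * V powr (1 / q)"
  proof -
    have 1: "c * X = X powr (1 / p) * V powr (1 / q)"
      using X pos q by (simp add: c_def powr_divide powr_diff)
    have "d = (V / X) powr (- 1 / p)"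
      using X pos q(1) by (simp add: d_def c_def powr_powr)
    then have "d * V = V powr (1 - 1 / p) * X powr (1 / p)"
      using X pos by (simp add: powr_divide powr_diff powr_minus field_simps)
    then have 2: "d * V = X powr (1 / p) * V powr (1 / q)"
      using q by simp
    have "c * X / p + d * V / q = X powr (1 / p) * V powr (1 / q) * (1 / p + 1 / q)"
      unfolding 1 2 by (simp add: algebra_simps)
    then show ?thesis using q by simp
  qed
  also have "X powr (1 / p) = B * M powr (1 / p)"
    using p pos by (simp add: X_def powr_mult powr_powr)
  finally show ?thesis using q by (simp add: mult_ac)
qed

text \<open>
  The constant of the next lemma. Its value is of no interest; what matters is that it does not
  depend on the sets and functions that are tested.
\<close>

definition heat_test_constant :: "nat \<Rightarrow> real \<Rightarrow> real \<Rightarrow> real \<Rightarrow> real \<Rightarrow> real" where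
  "heat_test_constant n p s b C\<^sub>0 =
     Gamma (s / 2 - b / p) * (C\<^sub>0 powr (1 / p) * ((2 * pi) ^ n) powr (1 - 1 / p))
       / (Gamma (s / 2) * (sqrt pi ^ n * exp (- 1 / 4) * unit_ball_vol n))"

text \<open>
  The pointwise inequality for the heat flow, integrated over \<open>E\<close>. On the left the heat flow at a time
  \<open>\<epsilon>\<close>, with \<open>\<surd>\<epsilon>\<close> less than the distance from \<open>E\<close> to the complement of \<open>E'\<close>, keeps \<open>v\<close> above a
  multiple of \<open>\<alpha>\<close>. On the right the heat flow is moved from \<open>|g|\<close> to the indicator of \<open>E\<close>, which at time
  \<open>r\<close> has sup norm at most \<open>C\<^sub>0 (\<kappa>/r) powr b\<close> and integral of order \<open>|E|\<close>; Hoelder then produces a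
  factor \<open>r powr (- b/p)\<close>, which is integrable against \<open>r powr (s/2 - 1)\<close> at 0 precisely because
  \<open>b < p s / 2\<close>. The factor \<open>exp (-r)\<close> takes care of large \<open>r\<close>.
\<close>

lemma heat_test_bound:
  fixes v :: "'a::euclidean_space \<Rightarrow> real" and g :: "'a \<Rightarrow> complex" and p s b :: real
  assumes p: "1 < p" and s: "0 < s" and b: "0 \<le> b" "b < p * s / 2" and C0: "0 < C\<^sub>0" and B: "0 < B"
    and deriv: "is_bessel_deriv s (regular_distr (\<lambda>x. of_real (v x))) g"
    and v_meas [measurable]: "v \<in> borel_measurable borel" and [measurable]: "g \<in> borel_measurable borel"
    and v: "\<And>x. 0 \<le> v x" "\<And>x. v x \<le> M"
    and gint: "(\<integral>\<^sup>+x. norm (g x) powr p \<partial>lborel) \<le> ennreal (B powr p)"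
    and E: "compact E" "0 < measure lborel E" and E': "open E'" "E \<subseteq> E'" "\<And>x. x \<in> E' \<Longrightarrow> \<alpha> \<le> v x"
    and \<alpha>: "0 \<le> \<alpha>" and \<kappa>: "0 < \<kappa>"
    and heat: "\<And>r x. 0 < r \<Longrightarrow> (\<integral>\<^sup>+y\<in>E. gauss_kernel r (x - y) \<partial>lborel) \<le> ennreal (C\<^sub>0 * (\<kappa> / r) powr b)"
  shows "\<alpha> * measure lborel E \<le>
    heat_test_constant DIM('a) p s b C\<^sub>0 * B * measure lborel E powr (1 - 1 / p) * \<kappa> powr (b / p)"
proof -
  define n where "n = DIM('a)"
  define c1 where "c1 = sqrt pi ^ n * exp (- 1 / 4) * unit_ball_vol n"
  have c1: "c1 > 0" by (simp add: c1_def)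
  have bp: "b / p < s / 2"
    using b p by (simp add: field_simps)
  define G where "G = Gamma (s / 2 - b / p)"
  have G: "G > 0" using bp by (simp add: G_def Gamma_real_pos)
  have \<Gamma>: "Gamma (s / 2) > 0" using s by (simp add: Gamma_real_pos)
  obtain e where e: "e > 0" "\<And>y. y \<in> E \<Longrightarrow> ball y e \<subseteq> E'"
    using compact_subset_open_imp_ball_epsilon_subset[OF E(1) E'(1,2)] by (metis UN_subset_iff)
  define \<epsilon> where "\<epsilon> = e\<^sup>2"
  have \<epsilon>: "\<epsilon> > 0" "sqrt \<epsilon> = e" using e(1) by (simp_all add: \<epsilon>_def)
  have [measurable]: "E \<in> sets borel" using E(1) by (simp add: compact_imp_closed)
  have Efin: "emeasure lborel E < \<infinity>" using E(1) by (rule emeasure_compact_finite)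
  then have emE: "emeasure lborel E = ennreal (measure lborel E)"
    by (simp add: emeasure_eq_ennreal_measure less_top)
  define V where "V = (2 * pi) ^ n * measure lborel E"
  have V: "V > 0" using E(2) by (simp add: V_def)

  have lower: "ennreal (\<alpha> * c1) \<le> (\<integral>\<^sup>+x. v x * gauss_kernel \<epsilon> (x - y) \<partial>lborel)" if "y \<in> E" for y
  proof -
    have [measurable]: "ball y (sqrt \<epsilon>) \<in> sets borel" by simp
    have "ennreal (\<alpha> * c1) = ennreal \<alpha> * ennreal c1"
      using \<alpha> c1 by (simp add: ennreal_mult)
    also have "\<dots> \<le> ennreal \<alpha> * (\<integral>\<^sup>+x\<in>ball y (sqrt \<epsilon>). gauss_kernel \<epsilon> (x - y) \<partial>lborel)"
      unfolding c1_def n_def by (intro mult_left_mono gauss_kernel_ball_lower_bound \<epsilon>) simp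
    also have "\<dots> = (\<integral>\<^sup>+x. ennreal \<alpha> * (ennreal (gauss_kernel \<epsilon> (x - y)) * indicator (ball y (sqrt \<epsilon>)) x) \<partial>lborel)"
      by (rule nn_integral_cmult[symmetric]) measurable
    also have "\<dots> \<le> (\<integral>\<^sup>+x. v x * gauss_kernel \<epsilon> (x - y) \<partial>lborel)"
    proof (rule nn_integral_mono)
      fix x
      show "ennreal \<alpha> * (ennreal (gauss_kernel \<epsilon> (x - y)) * indicator (ball y (sqrt \<epsilon>)) x) \<le> ennreal (v x * gauss_kernel \<epsilon> (x - y))"
      proof (cases "x \<in> ball y (sqrt \<epsilon>)")
        case True
        then have "\<alpha> \<le> v x" using e(2)[OF that] E'(3) \<epsilon> by blast
        then show ?thesis using True \<epsilon> \<alpha>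
          by (auto simp: mult_right_mono ennreal_leI simp flip: ennreal_mult')
      qed simp
    qed
    finally show ?thesis .
  qed

  \<comment> \<open>replacing \<open>r + \<epsilon>\<close> by \<open>r\<close> at the end only increases the bound, as the power of \<open>\<kappa>/r\<close> is nonnegative\<close>
  have upper: "(\<integral>\<^sup>+x. norm (g x) * (\<integral>\<^sup>+y\<in>E. gauss_kernel (r + \<epsilon>) (x - y) \<partial>lborel) \<partial>lborel)
      \<le> ennreal (C\<^sub>0 powr (1 / p) * ((2 * pi) ^ n) powr (1 - 1 / p) * B * measure lborel E powr (1 - 1 / p) * \<kappa> powr (b / p) * r powr (- b / p))"
    if r: "r > 0" for r
  proof -
    have "(\<integral>\<^sup>+x. norm (g x) * (\<integral>\<^sup>+y\<in>E. gauss_kernel (r + \<epsilon>) (x - y) \<partial>lborel) \<partial>lborel)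
        \<le> ennreal (B * (C\<^sub>0 * (\<kappa> / (r + \<epsilon>)) powr b) powr (1 / p) * V powr (1 - 1 / p))"
    proof (rule holder_bounded_weight[OF p B])
      show "0 < C\<^sub>0 * (\<kappa> / (r + \<epsilon>)) powr b" using C0 \<kappa> r \<epsilon> by simp
      show "(\<integral>\<^sup>+y\<in>E. gauss_kernel (r + \<epsilon>) (x - y) \<partial>lborel) \<le> ennreal (C\<^sub>0 * (\<kappa> / (r + \<epsilon>)) powr b)" for x
        using r \<epsilon> by (intro heat) auto
      have "(\<integral>\<^sup>+x. (\<integral>\<^sup>+y\<in>E. gauss_kernel (r + \<epsilon>) (x - y) \<partial>lborel) \<partial>lborel)
         = (\<integral>\<^sup>+y. (\<integral>\<^sup>+x. ennreal (gauss_kernel (r + \<epsilon>) (x - y)) * indicator E y \<partial>lborel) \<partial>lborel)"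
        by (rule lborel_pair.Fubini') measurable
      also have "\<dots> = (\<integral>\<^sup>+y. ennreal ((2 * pi) ^ n) * indicator E y \<partial>lborel)"
        using r \<epsilon> by (intro nn_integral_cong) (simp add: nn_integral_multc nn_integral_gauss_kernel n_def)
      also have "\<dots> = ennreal V"
        by (simp add: nn_integral_cmult_indicator emE V_def ennreal_mult)
      finally show "(\<integral>\<^sup>+x. (\<integral>\<^sup>+y\<in>E. gauss_kernel (r + \<epsilon>) (x - y) \<partial>lborel) \<partial>lborel) \<le> ennreal V"
        by simp
    qed (use V gint in auto)
    also have "\<dots> \<le> ennreal (B * (C\<^sub>0 * (\<kappa> / r) powr b) powr (1 / p) * V powr (1 - 1 / p))"
    proof (intro ennreal_leI mult_right_mono mult_left_mono powr_mono2 divide_left_mono)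
    qed (use B C0 b p r \<epsilon> \<kappa> in auto)
    also have "B * (C\<^sub>0 * (\<kappa> / r) powr b) powr (1 / p) * V powr (1 - 1 / p)
       = C\<^sub>0 powr (1 / p) * ((2 * pi) ^ n) powr (1 - 1 / p) * B * measure lborel E powr (1 - 1 / p) * \<kappa> powr (b / p) * r powr (- b / p)"
      using C0 \<kappa> r E(2) by (simp add: V_def powr_mult powr_powr powr_divide powr_minus field_simps)
    finally show ?thesis .
  qed

  define X where "X = C\<^sub>0 powr (1 / p) * ((2 * pi) ^ n) powr (1 - 1 / p) * B * measure lborel E powr (1 - 1 / p) * \<kappa> powr (b / p)"
  have X: "X \<ge> 0" using B by (simp add: X_def)
  have "ennreal (Gamma (s / 2) * (\<alpha> * c1) * measure lborel E)
      = (\<integral>\<^sup>+y. ennreal (Gamma (s / 2) * (\<alpha> * c1)) * indicator E y \<partial>lborel)"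
    using \<Gamma> \<alpha> c1 by (simp add: nn_integral_cmult_indicator emE ennreal_mult)
  also have "\<dots> \<le> (\<integral>\<^sup>+y. (\<integral>\<^sup>+r. gamma_weight (s / 2) r *
        (\<integral>\<^sup>+x. norm (g x) * gauss_kernel (r + \<epsilon>) (x - y) \<partial>lborel) \<partial>lborel) * indicator E y \<partial>lborel)"
  proof (rule nn_integral_mono)
    fix y
    show "ennreal (Gamma (s / 2) * (\<alpha> * c1)) * indicator E y \<le>
       (\<integral>\<^sup>+r. gamma_weight (s / 2) r * (\<integral>\<^sup>+x. norm (g x) * gauss_kernel (r + \<epsilon>) (x - y) \<partial>lborel) \<partial>lborel) * indicator E y"
    proof (cases "y \<in> E")
      case True
      have "ennreal (Gamma (s / 2) * (\<alpha> * c1)) = ennreal (Gamma (s / 2)) * ennreal (\<alpha> * c1)"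
        using \<Gamma> \<alpha> c1 by (simp add: ennreal_mult)
      also have "\<dots> \<le> ennreal (Gamma (s / 2)) * (\<integral>\<^sup>+x. v x * gauss_kernel \<epsilon> (x - y) \<partial>lborel)"
        by (intro mult_left_mono lower True) simp
      also have "\<dots> \<le> (\<integral>\<^sup>+r. gamma_weight (s / 2) r * (\<integral>\<^sup>+x. norm (g x) * gauss_kernel (r + \<epsilon>) (x - y) \<partial>lborel) \<partial>lborel)"
        using deriv s \<epsilon>(1) v by (intro bessel_deriv_heat_bound) auto
      finally show ?thesis using True by simp
    qed simp
  qed
  also have "\<dots> = (\<integral>\<^sup>+y. (\<integral>\<^sup>+r. gamma_weight (s / 2) r *
        (\<integral>\<^sup>+x. norm (g x) * gauss_kernel (r + \<epsilon>) (x - y) \<partial>lborel) * indicator E y \<partial>lborel) \<partial>lborel)"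
    by (intro nn_integral_cong nn_integral_multc[symmetric]) measurable
  also have "\<dots> = (\<integral>\<^sup>+r. (\<integral>\<^sup>+y. gamma_weight (s / 2) r *
        (\<integral>\<^sup>+x. norm (g x) * gauss_kernel (r + \<epsilon>) (x - y) \<partial>lborel) * indicator E y \<partial>lborel) \<partial>lborel)"
    by (rule lborel_pair.Fubini') measurable
  also have "\<dots> = (\<integral>\<^sup>+r. gamma_weight (s / 2) r *
        (\<integral>\<^sup>+x. norm (g x) * (\<integral>\<^sup>+y\<in>E. gauss_kernel (r + \<epsilon>) (x - y) \<partial>lborel) \<partial>lborel) \<partial>lborel)"
  proof (rule nn_integral_cong)
    fix r
    have "(\<integral>\<^sup>+y. gamma_weight (s / 2) r *
        (\<integral>\<^sup>+x. norm (g x) * gauss_kernel (r + \<epsilon>) (x - y) \<partial>lborel) * indicator E y \<partial>lborel)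
      = gamma_weight (s / 2) r * (\<integral>\<^sup>+y. (\<integral>\<^sup>+x. norm (g x) * gauss_kernel (r + \<epsilon>) (x - y) \<partial>lborel) * indicator E y \<partial>lborel)"
      by (subst nn_integral_cmult[symmetric]) (auto simp: mult_ac)
    also have "(\<integral>\<^sup>+y. (\<integral>\<^sup>+x. norm (g x) * gauss_kernel (r + \<epsilon>) (x - y) \<partial>lborel) * indicator E y \<partial>lborel)
      = (\<integral>\<^sup>+y. (\<integral>\<^sup>+x. ennreal (norm (g x) * gauss_kernel (r + \<epsilon>) (x - y)) * indicator E y \<partial>lborel) \<partial>lborel)"
      by (intro nn_integral_cong nn_integral_multc[symmetric]) measurable
    also have "\<dots> = (\<integral>\<^sup>+x. (\<integral>\<^sup>+y. ennreal (norm (g x) * gauss_kernel (r + \<epsilon>) (x - y)) * indicator E y \<partial>lborel) \<partial>lborel)"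
      by (rule lborel_pair.Fubini') measurable
    also have "\<dots> = (\<integral>\<^sup>+x. norm (g x) * (\<integral>\<^sup>+y\<in>E. gauss_kernel (r + \<epsilon>) (x - y) \<partial>lborel) \<partial>lborel)"
      by (intro nn_integral_cong, subst nn_integral_cmult[symmetric])
        (auto intro!: nn_integral_cong simp: ennreal_mult' mult_ac)
    finally show "(\<integral>\<^sup>+y. gamma_weight (s / 2) r *
        (\<integral>\<^sup>+x. norm (g x) * gauss_kernel (r + \<epsilon>) (x - y) \<partial>lborel) * indicator E y \<partial>lborel) =
      gamma_weight (s / 2) r * (\<integral>\<^sup>+x. norm (g x) * (\<integral>\<^sup>+y\<in>E. gauss_kernel (r + \<epsilon>) (x - y) \<partial>lborel) \<partial>lborel)" .
  qed
  also have "\<dots> \<le> (\<integral>\<^sup>+r. ennreal X * ennreal (gamma_weight (s / 2 - b / p) r) \<partial>lborel)"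
  proof (rule nn_integral_mono)
    fix r :: real
    show "gamma_weight (s / 2) r * (\<integral>\<^sup>+x. norm (g x) * (\<integral>\<^sup>+y\<in>E. gauss_kernel (r + \<epsilon>) (x - y) \<partial>lborel) \<partial>lborel)
      \<le> ennreal X * ennreal (gamma_weight (s / 2 - b / p) r)"
    proof (cases "r > 0")
      case True
      have "gamma_weight (s / 2) r * (\<integral>\<^sup>+x. norm (g x) * (\<integral>\<^sup>+y\<in>E. gauss_kernel (r + \<epsilon>) (x - y) \<partial>lborel) \<partial>lborel)
        \<le> gamma_weight (s / 2) r * ennreal (X * r powr (- b / p))"
        using upper[OF True] by (intro mult_left_mono) (simp_all add: X_def)
      also have "\<dots> = ennreal (gamma_weight (s / 2) r * (X * r powr (- b / p)))"
        by (simp add: ennreal_mult')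
      also have "gamma_weight (s / 2) r * (X * r powr (- b / p)) = X * gamma_weight (s / 2 - b / p) r"
      proof -
        have "r powr (s / 2 - 1) * r powr (- b / p) = r powr (s / 2 - b / p - 1)"
          by (simp add: algebra_simps flip: powr_add)
        then show ?thesis
          using True by (simp add: gamma_weight_def mult_ac)
      qed
      finally show ?thesis using X by (simp add: ennreal_mult')
    qed (simp add: gamma_weight_def)
  qed
  also have "\<dots> = ennreal X * (\<integral>\<^sup>+r. gamma_weight (s / 2 - b / p) r \<partial>lborel)"
    by (rule nn_integral_cmult) measurable
  also have "(\<integral>\<^sup>+r. gamma_weight (s / 2 - b / p) r \<partial>lborel) = ennreal G"
  proof -
    have "has_bochner_integral lborel (gamma_weight (s / 2 - b / p)) G"
      using gamma_weight_integral[of "s / 2 - b / p" 1] bp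
      by (simp add: gamma_weight_def[abs_def] G_def)
    then show ?thesis
      by (subst nn_integral_eq_integral) (auto simp: has_bochner_integral_iff)
  qed
  also have "ennreal X * ennreal G = ennreal (X * G)"
    using X G by (simp add: ennreal_mult)
  finally have "Gamma (s / 2) * (\<alpha> * c1) * measure lborel E \<le> X * G"
    using X G by (subst (asm) ennreal_le_iff) auto
  then have "\<alpha> * measure lborel E \<le> X * G / (Gamma (s / 2) * c1)"
    using \<Gamma> c1 by (simp add: field_simps)
  then show ?thesis
    by (simp add: X_def heat_test_constant_def G_def c1_def n_def mult_ac)
qed

text \<open>
  This unfolds the choice in the definition of the Sobolev norm. Enlarging the constant makes it
  positive.
\<close>

lemma bounded_Lp_comp_to_sobolev_bessel_deriv:
  assumes bdd: "bounded_Lp_comp_to_sobolev p s A" and K: "compact K" and p: "p > 1"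
  obtains C where "C > 0"
    "\<And>f. f \<in> Lp_space p \<Longrightarrow> AE x in lborel. x \<notin> K \<longrightarrow> f x = 0 \<Longrightarrow>
      \<exists>g. g \<in> borel_measurable borel \<and> is_bessel_deriv s (regular_distr (A f)) g \<and>
        (\<integral>\<^sup>+x. norm (g x) powr p \<partial>lborel) \<le> ennreal ((C * Lp_norm p f) powr p)"
proof -
  obtain C1 where C1: "\<And>f. f \<in> Lp_space p \<Longrightarrow> (AE x in lborel. x \<notin> K \<longrightarrow> f x = 0) \<Longrightarrow>
       regular_distr (A f) \<in> sobolev_space p s \<and>
       sobolev_norm p s (regular_distr (A f)) \<le> C1 * Lp_norm p f"
    using bdd K unfolding bounded_Lp_comp_to_sobolev_def by blast
  show ?thesis
  proof (rule that[of "max C1 1"])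
    fix f assume f: "f \<in> Lp_space p" "AE x in lborel. x \<notin> K \<longrightarrow> f x = 0"
    define g where "g = (SOME g. g \<in> Lp_space p \<and> is_bessel_deriv s (regular_distr (A f)) g)"
    have "\<exists>g. g \<in> Lp_space p \<and> is_bessel_deriv s (regular_distr (A f)) g"
      using C1[OF f] by (auto simp: sobolev_space_def)
    from someI_ex[OF this] have g: "g \<in> Lp_space p" and deriv: "is_bessel_deriv s (regular_distr (A f)) g"
      by (simp_all add: g_def)
    have "Lp_norm p g \<le> C1 * Lp_norm p f"
      using C1[OF f] by (simp add: sobolev_norm_def g_def)
    also have "\<dots> \<le> max C1 1 * Lp_norm p f"
      by (intro mult_right_mono) (auto simp: Lp_norm_def)
    finally have gB: "Lp_norm p g \<le> max C1 1 * Lp_norm p f" .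
    have "(\<integral>\<^sup>+x. norm (g x) powr p \<partial>lborel) = ennreal (\<integral>x. norm (g x) powr p \<partial>lborel)"
      using g by (intro nn_integral_eq_integral) (auto simp: Lp_space_def)
    also have "(\<integral>x. norm (g x) powr p \<partial>lborel) = (Lp_norm p g) powr p"
      using p by (simp add: Lp_norm_def powr_powr)
    also have "\<dots> \<le> (max C1 1 * Lp_norm p f) powr p"
      using gB p by (intro powr_mono2) (auto simp: Lp_norm_def)
    finally have "(\<integral>\<^sup>+x. norm (g x) powr p \<partial>lborel) \<le> ennreal ((max C1 1 * Lp_norm p f) powr p)"
      by (simp add: ennreal_leI)
    moreover have "g \<in> borel_measurable borel" using g by (simp add: Lp_space_def)
    ultimately show "\<exists>g. g \<in> borel_measurable borel \<and> is_bessel_deriv s (regular_distr (A f)) g \<and>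
        (\<integral>\<^sup>+x. norm (g x) powr p \<partial>lborel) \<le> ennreal ((max C1 1 * Lp_norm p f) powr p)"
      using deriv by blast
  qed simp
qed

lemma indicator_Lp:
  fixes F :: "'a::euclidean_space set"
  assumes [measurable]: "F \<in> sets borel" and W: "emeasure lborel F \<le> ennreal W" "0 \<le> W" and p: "0 < p"
  shows "(\<lambda>x. of_real (indicator F x)) \<in> Lp_space p"
    and "Lp_norm p (\<lambda>x. of_real (indicator F x) :: complex) \<le> W powr (1 / p)"
proof -
  have pow: "norm (of_real (indicator F x) :: complex) powr p = indicator F x" for x
    using p by (simp add: indicator_def)
  have fin: "emeasure lborel F < \<infinity>"
    using W(1) by (rule le_less_trans) simp
  then show "(\<lambda>x. of_real (indicator F x)) \<in> Lp_space p"
    unfolding Lp_space_def mem_Collect_eq pow by simp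
  have "measure lborel F \<le> W"
    using W by (simp add: measure_def enn2real_leI)
  then show "Lp_norm p (\<lambda>x. of_real (indicator F x) :: complex) \<le> W powr (1 / p)"
    unfolding Lp_norm_def pow using p by (simp add: powr_mono2)
qed

text \<open>
  Otherwise \<open>c \<le> C \<delta> powr (y - x)\<close> for all small \<open>\<delta>\<close>, although the right-hand side tends to 0.
\<close>

lemma powr_exponent_le:
  fixes x y c C \<delta>0 :: real
  assumes "c > 0" "\<delta>0 > 0" "\<And>\<delta>. 0 < \<delta> \<Longrightarrow> \<delta> \<le> \<delta>0 \<Longrightarrow> c * \<delta> powr x \<le> C * \<delta> powr y"
  shows "y \<le> x"
proof (rule ccontr)
  assume "\<not> y \<le> x"
  then have yx: "y - x > 0" by simp
  have le: "c \<le> C * \<delta> powr (y - x)" if "0 < \<delta>" "\<delta> \<le> \<delta>0" for \<delta>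
    using assms(3)[OF that] that by (simp add: powr_diff field_simps)
  have "0 < C * \<delta>0 powr (y - x)" using le[of \<delta>0] assms(1,2) by auto
  then have C: "C > 0" using zero_less_mult_pos2 assms(2) by (metis powr_gt_zero less_irrefl)
  define \<delta> where "\<delta> = min \<delta>0 ((c / (2 * C)) powr (1 / (y - x)))"
  have "\<delta> > 0" using assms(1,2) C by (simp add: \<delta>_def)
  have "c \<le> C * \<delta> powr (y - x)" using \<open>\<delta> > 0\<close> by (intro le) (auto simp: \<delta>_def)
  also have "\<dots> \<le> C * ((c / (2 * C)) powr (1 / (y - x))) powr (y - x)"
    using C yx \<open>\<delta> > 0\<close> by (intro mult_left_mono powr_mono2) (auto simp: \<delta>_def)
  also have "\<dots> = c / 2" using C yx assms(1) by (simp add: powr_powr)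
  finally show False using assms(1) by simp
qed

text \<open>
  The inequality of \<open>heat_test_bound\<close>, for \<open>F\<close> of measure at most \<open>w \<delta>\<^sup>i\<close>, \<open>E\<close> of measure \<open>e \<delta>\<^sup>j\<close>,
  averages at least \<open>\<alpha> \<delta>\<^sup>k\<close> near \<open>E\<close>, and \<open>\<kappa> = \<delta>\<^sup>n\<close>, reads
  \<open>\<delta> powr (k + j) \<le> const \<delta> powr (i/p + j (1 - 1/p) + n b/p)\<close>. The conclusion compares the exponents.
\<close>

lemma test_family_exponents:
  fixes A :: "('a::euclidean_space \<Rightarrow> complex) \<Rightarrow> 'a \<Rightarrow> complex"
    and F E :: "real \<Rightarrow> 'a set" and p s b :: real and i j k n :: nat
  assumes bdd: "bounded_Lp_comp_to_sobolev p s A" and K: "compact K"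
    and p: "1 < p" and s: "0 < s" and b: "0 \<le> b" "b < p * s / 2"
    and pos: "0 < \<delta>\<^sub>0" "0 < w" "0 < e" "0 < \<alpha>" "0 < C\<^sub>0"
    and F: "\<And>\<delta>. 0 < \<delta> \<Longrightarrow> \<delta> \<le> \<delta>\<^sub>0 \<Longrightarrow> F \<delta> \<in> sets borel \<and> F \<delta> \<subseteq> K \<and> emeasure lborel (F \<delta>) \<le> ennreal (w * \<delta> ^ i)"
    and E: "\<And>\<delta>. 0 < \<delta> \<Longrightarrow> \<delta> \<le> \<delta>\<^sub>0 \<Longrightarrow> compact (E \<delta>) \<and> measure lborel (E \<delta>) = e * \<delta> ^ j"
    and average: "\<And>\<delta>. 0 < \<delta> \<Longrightarrow> \<delta> \<le> \<delta>\<^sub>0 \<Longrightarrow> \<exists>v E'. v \<in> borel_measurable borel \<and> (\<forall>x. 0 \<le> v x \<and> v x \<le> M) \<and>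
        (\<forall>x. A (\<lambda>x. of_real (indicator (F \<delta>) x)) x = of_real (v x)) \<and>
        open E' \<and> E \<delta> \<subseteq> E' \<and> (\<forall>x\<in>E'. \<alpha> * \<delta> ^ k \<le> v x)"
    and heat: "\<And>\<delta> r x. 0 < \<delta> \<Longrightarrow> \<delta> \<le> \<delta>\<^sub>0 \<Longrightarrow> 0 < r \<Longrightarrow>
        (\<integral>\<^sup>+y\<in>E \<delta>. gauss_kernel r (x - y) \<partial>lborel) \<le> ennreal (C\<^sub>0 * (\<delta> ^ n / r) powr b)"
  shows "i + n * b \<le> p * k + j"
proof -
  obtain C where C: "C > 0" and deriv: "\<And>f. f \<in> Lp_space p \<Longrightarrow> AE x in lborel. x \<notin> K \<longrightarrow> f x = 0 \<Longrightarrow>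
      \<exists>g. g \<in> borel_measurable borel \<and> is_bessel_deriv s (regular_distr (A f)) g \<and>
        (\<integral>\<^sup>+x. norm (g x) powr p \<partial>lborel) \<le> ennreal ((C * Lp_norm p f) powr p)"
    using bounded_Lp_comp_to_sobolev_bessel_deriv[OF bdd K p] by blast
  define H where "H = heat_test_constant DIM('a) p s b C\<^sub>0"
  have main: "\<alpha> * e * \<delta> powr (real k + j)
      \<le> (H * C * w powr (1 / p) * e powr (1 - 1 / p)) * \<delta> powr (i * (1 / p) + j * (1 - 1 / p) + n * (b / p))"
    if \<delta>: "0 < \<delta>" "\<delta> \<le> \<delta>\<^sub>0" for \<delta>
  proof -
    obtain v E' where v: "v \<in> borel_measurable borel" "\<And>x. 0 \<le> v x" "\<And>x. v x \<le> M"
        "\<And>x. A (\<lambda>x. of_real (indicator (F \<delta>) x)) x = of_real (v x)"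
      and E': "open E'" "E \<delta> \<subseteq> E'" "\<And>x. x \<in> E' \<Longrightarrow> \<alpha> * \<delta> ^ k \<le> v x"
      using average[OF \<delta>] by blast
    let ?f = "\<lambda>x. complex_of_real (indicator (F \<delta>) x)"
    have Fb: "F \<delta> \<in> sets borel" and FK: "F \<delta> \<subseteq> K" and Fm: "emeasure lborel (F \<delta>) \<le> ennreal (w * \<delta> ^ i)"
      using F[OF \<delta>] by blast+
    have W: "0 \<le> w * \<delta> ^ i" using pos \<delta> by simp
    have Lp: "?f \<in> Lp_space p" "Lp_norm p ?f \<le> (w * \<delta> ^ i) powr (1 / p)"
      using indicator_Lp[OF Fb Fm W] p by auto
    have supp: "AE x in lborel. x \<notin> K \<longrightarrow> ?f x = 0"
      using FK by (intro AE_I2) (auto simp: indicator_def)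
    obtain g where g: "g \<in> borel_measurable borel" "is_bessel_deriv s (regular_distr (A ?f)) g"
        "(\<integral>\<^sup>+x. norm (g x) powr p \<partial>lborel) \<le> ennreal ((C * Lp_norm p ?f) powr p)"
      using deriv[OF Lp(1) supp] by blast
    define B where "B = C * (w * \<delta> ^ i) powr (1 / p)"
    have B: "0 < B" using C pos \<delta> by (simp add: B_def)
    have "(C * Lp_norm p ?f) powr p \<le> B powr p"
      using Lp(2) C p unfolding B_def by (intro powr_mono2 mult_left_mono) (auto simp: Lp_norm_def)
    then have gB: "(\<integral>\<^sup>+x. norm (g x) powr p \<partial>lborel) \<le> ennreal (B powr p)"
      using g(3) by (meson ennreal_leI order_trans)
    have Av: "A ?f = (\<lambda>x. of_real (v x))" using v(4) by (simp add: fun_eq_iff)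
    have "\<alpha> * \<delta> ^ k * measure lborel (E \<delta>) \<le> H * B * measure lborel (E \<delta>) powr (1 - 1 / p) * (\<delta> ^ n) powr (b / p)"
      unfolding H_def
      by (rule heat_test_bound[OF p s b pos(5) B g(2)[unfolded Av] v(1) g(1) v(2,3) gB _ _ E'])
        (use E[OF \<delta>] heat[OF \<delta>] \<delta> pos in auto)
    then have "\<alpha> * \<delta> ^ k * (e * \<delta> ^ j) \<le> H * B * (e * \<delta> ^ j) powr (1 - 1 / p) * (\<delta> ^ n) powr (b / p)"
      using E[OF \<delta>] by simp
    also have "\<dots> = H * (C * (w powr (1 / p) * \<delta> powr (i * (1 / p)))) * (e powr (1 - 1 / p) * \<delta> powr (j * (1 - 1 / p)))
        * \<delta> powr (n * (b / p))"
      using \<delta> pos by (simp add: B_def powr_mult powr_powr flip: powr_realpow)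
    also have "\<dots> = (H * C * w powr (1 / p) * e powr (1 - 1 / p)) * \<delta> powr (i * (1 / p) + j * (1 - 1 / p) + n * (b / p))"
      by (simp add: powr_add mult_ac)
    also have "\<alpha> * \<delta> ^ k * (e * \<delta> ^ j) = \<alpha> * e * \<delta> powr (real k + j)"
      using \<delta> by (simp add: powr_add powr_realpow)
    finally show ?thesis .
  qed
  have "i * (1 / p) + j * (1 - 1 / p) + n * (b / p) \<le> real k + j"
    by (rule powr_exponent_le[OF _ pos(1) main]) (use pos in auto)
  then show ?thesis using p by (simp add: field_simps)
qed

text \<open>
  The heat flow of an indicator function is bounded trivially by a constant and, after the set has been
  smeared out, by a power of \<open>t = \<kappa>/r\<close>. The first bound is better for \<open>t \<ge> 1\<close>, the second for
  \<open>t \<le> 1\<close>, and together they give all smaller powers.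
\<close>

lemma min_le_powr_interpolation:
  fixes h :: ennreal
  assumes "h \<le> ennreal P" "h \<le> ennreal (Q * t powr a)" "0 < t" "0 \<le> b" "b \<le> a" "0 \<le> P" "0 \<le> Q"
  shows "h \<le> ennreal ((P + Q) * t powr b)"
proof (cases "t \<le> 1")
  case True
  have "Q * t powr a \<le> (P + Q) * t powr b"
    using assms True by (intro mult_mono powr_mono') auto
  then show ?thesis using assms(2) by (meson ennreal_leI order_trans)
next
  case False
  then have "1 \<le> t powr b" using assms by (intro ge_one_powr_ge_zero) auto
  then have "P * 1 \<le> (P + Q) * t powr b"
    using assms by (intro mult_mono) auto
  then show ?thesis using assms(1) by (metis ennreal_leI mult.right_neutral order_trans)
qed

section \<open>Integration over three-space\<close>

lemma Basis_real3: "(Basis :: (real^3) set) = {axis 1 1, axis 2 1, axis 3 1}"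
proof -
  have "(Basis :: (real^3) set) = (\<lambda>i. axis i 1) ` UNIV"
    by (auto simp: Basis_vec_def)
  then show ?thesis by (simp add: UNIV_3)
qed

lemma vector3_measurable [measurable]:
  assumes [measurable]: "f \<in> borel_measurable M" "g \<in> borel_measurable M" "h \<in> borel_measurable M"
  shows "(\<lambda>p. vector [f p, g p, h p] :: real^3) \<in> borel_measurable M"
proof -
  have "(\<lambda>p. vector [f p, g p, h p] :: real^3) =
     (\<lambda>p. f p *\<^sub>R axis 1 1 + g p *\<^sub>R axis 2 1 + h p *\<^sub>R axis 3 1)"
    by (auto simp: fun_eq_iff vec_eq_iff forall_3 axis_def)
  then show ?thesis by simp
qed

lemma continuous_on_vector3:
  assumes "continuous_on S f" "continuous_on S g" "continuous_on S h"
  shows "continuous_on S (\<lambda>x. vector [f x, g x, h x] :: real^3)"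
proof -
  have eq: "(\<lambda>x. vector [f x, g x, h x] :: real^3) =
     (\<lambda>x. f x *\<^sub>R axis 1 1 + g x *\<^sub>R axis 2 1 + h x *\<^sub>R axis 3 1)"
    by (auto simp: fun_eq_iff vec_eq_iff forall_3 axis_def)
  show ?thesis
    unfolding eq by (intro continuous_intros assms)
qed

lemma sigma_finite_lborel_prod: "sigma_finite_measure (lborel \<Otimes>\<^sub>M lborel :: (real \<times> real) measure)"
  unfolding lborel_prod by (rule sigma_finite_lborel)

text \<open>
  Identifying the space of triples with an iterated product makes Fubini's theorem available for
  individual coordinates.
\<close>

lemma lborel_real3:
  "(lborel :: (real^3) measure) = distr (lborel \<Otimes>\<^sub>M (lborel \<Otimes>\<^sub>M lborel)) borel (\<lambda>(a, b, c). vector [a, b, c])"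
proof (rule lborel_eqI)
  fix l u :: "real^3"
  assume le: "\<And>b. b \<in> Basis \<Longrightarrow> l \<bullet> b \<le> u \<bullet> b"
  let ?T = "\<lambda>(a, b, c). vector [a, b, c] :: real^3"
  have ne: "axis 1 1 \<noteq> (axis 2 1 :: real^3)" "axis 1 1 \<noteq> (axis 3 1 :: real^3)" "axis 2 1 \<noteq> (axis 3 1 :: real^3)"
    by (auto simp: axis_eq_axis)
  have le3: "l $ 1 \<le> u $ 1" "l $ 2 \<le> u $ 2" "l $ 3 \<le> u $ 3"
    using le[of "axis 1 1"] le[of "axis 2 1"] le[of "axis 3 1"] by (auto simp: Basis_real3 inner_axis)
  have "?T -` box l u = {l$1<..<u$1} \<times> ({l$2<..<u$2} \<times> {l$3<..<u$3})"
    by (auto simp: mem_box_cart forall_3)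
  then have "emeasure (distr (lborel \<Otimes>\<^sub>M (lborel \<Otimes>\<^sub>M lborel)) borel ?T) (box l u)
     = emeasure (lborel \<Otimes>\<^sub>M (lborel \<Otimes>\<^sub>M lborel)) ({l$1<..<u$1} \<times> ({l$2<..<u$2} \<times> {l$3<..<u$3}))"
    by (subst emeasure_distr) (auto simp: space_pair_measure)
  also have "\<dots> = ennreal (u$1 - l$1) * (ennreal (u$2 - l$2) * ennreal (u$3 - l$3))"
  proof -
    have "emeasure (lborel \<Otimes>\<^sub>M lborel) ({l$2<..<u$2} \<times> {l$3<..<u$3}) = ennreal (u$2 - l$2) * ennreal (u$3 - l$3)"
      using le3 by (subst lborel.emeasure_pair_measure_Times) auto
    moreover have "emeasure (lborel \<Otimes>\<^sub>M (lborel \<Otimes>\<^sub>M lborel)) ({l$1<..<u$1} \<times> ({l$2<..<u$2} \<times> {l$3<..<u$3}))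
      = emeasure lborel {l$1<..<u$1} * emeasure (lborel \<Otimes>\<^sub>M lborel) ({l$2<..<u$2} \<times> {l$3<..<u$3})"
      by (rule sigma_finite_measure.emeasure_pair_measure_Times[OF sigma_finite_lborel_prod]) auto
    ultimately show ?thesis using le3 by simp
  qed
  also have "\<dots> = ennreal (\<Prod>b\<in>Basis. (u - l) \<bullet> b)"
    using le3 ne by (simp add: Basis_real3 inner_axis mult.assoc flip: ennreal_mult)
  finally show "emeasure (distr (lborel \<Otimes>\<^sub>M (lborel \<Otimes>\<^sub>M lborel)) borel ?T) (box l u) = (\<Prod>b\<in>Basis. (u - l) \<bullet> b)" .
qed simp

lemma nn_integral_real3:
  assumes [measurable]: "f \<in> borel_measurable borel"
  shows "(\<integral>\<^sup>+x. f x \<partial>lborel) = (\<integral>\<^sup>+a. \<integral>\<^sup>+b. \<integral>\<^sup>+c. f (vector [a, b, c] :: real^3) \<partial>lborel \<partial>lborel \<partial>lborel)"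
proof -
  have m: "(\<lambda>p. f (vector [fst p, fst (snd p), snd (snd p)])) \<in> borel_measurable (lborel \<Otimes>\<^sub>M (lborel \<Otimes>\<^sub>M lborel))"
    by measurable
  have "(\<integral>\<^sup>+x. f x \<partial>lborel) = (\<integral>\<^sup>+p. f (vector [fst p, fst (snd p), snd (snd p)]) \<partial>(lborel \<Otimes>\<^sub>M (lborel \<Otimes>\<^sub>M lborel)))"
    by (subst lborel_real3, subst nn_integral_distr) (auto simp: case_prod_beta)
  also have "\<dots> = (\<integral>\<^sup>+a. \<integral>\<^sup>+p. f (vector [a, fst p, snd p]) \<partial>(lborel \<Otimes>\<^sub>M lborel) \<partial>lborel)"
    using m by (subst sigma_finite_measure.nn_integral_fst[OF sigma_finite_lborel_prod, symmetric]) auto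
  also have "\<dots> = (\<integral>\<^sup>+a. \<integral>\<^sup>+b. \<integral>\<^sup>+c. f (vector [a, b, c]) \<partial>lborel \<partial>lborel \<partial>lborel)"
  proof (rule nn_integral_cong)
    fix a
    show "(\<integral>\<^sup>+p. f (vector [a, fst p, snd p]) \<partial>(lborel \<Otimes>\<^sub>M lborel)) = (\<integral>\<^sup>+b. \<integral>\<^sup>+c. f (vector [a, b, c]) \<partial>lborel \<partial>lborel)"
      by (subst lborel.nn_integral_fst[symmetric]) auto
  qed
  finally show ?thesis .
qed

lemma gauss_kernel_vector:
  "gauss_kernel r (x - vector [a, b, c] :: real^3) = gauss_kernel r (x$1 - a) * (gauss_kernel r (x$2 - b) * gauss_kernel r (x$3 - c))"
proof -
  have "(norm (x - vector [a, b, c]))\<^sup>2 = (x$1 - a)\<^sup>2 + (x$2 - b)\<^sup>2 + (x$3 - c)\<^sup>2"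
    unfolding power2_norm_eq_inner by (simp add: inner_vec_def sum_3 power2_eq_square)
  then have "- (norm (x - vector [a, b, c]))\<^sup>2 / (4 * r)
      = - (x$1 - a)\<^sup>2 / (4 * r) + (- (x$2 - b)\<^sup>2 / (4 * r) + - (x$3 - c)\<^sup>2 / (4 * r))"
    by (simp add: add_divide_distrib diff_divide_distrib)
  then have "exp (- (norm (x - vector [a, b, c]))\<^sup>2 / (4 * r))
      = exp (- (x$1 - a)\<^sup>2 / (4 * r)) * (exp (- (x$2 - b)\<^sup>2 / (4 * r)) * exp (- (x$3 - c)\<^sup>2 / (4 * r)))"
    by (simp only: exp_add)
  moreover have "q ^ 3 * (u * (v * w)) = (q * u) * ((q * v) * (q * w))" for q u v w :: real
    by (simp add: power3_eq_cube)
  moreover have "gauss_kernel r t = sqrt (pi / r) * exp (- t\<^sup>2 / (4 * r))" for t :: real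
    by (simp add: gauss_kernel_def)
  moreover have "gauss_kernel r z = sqrt (pi / r) ^ 3 * exp (- (norm z)\<^sup>2 / (4 * r))" for z :: "real^3"
    by (simp add: gauss_kernel_def)
  ultimately show ?thesis
    by (simp only:)
qed

text \<open>
  The kernel is a product of one-dimensional kernels. In the third variable its supremum meets a set of
  measure at most \<open>L\<close>; in the other two it has integral \<open>2 \<pi>\<close>.
\<close>

lemma nn_integral_gauss_kernel_le_section:
  fixes x :: "real^3"
  assumes r: "r > 0" and [measurable]: "E \<in> sets borel" and L: "0 \<le> L"
    "\<And>a b. emeasure lborel {c. vector [a, b, c] \<in> E} \<le> ennreal L"
  shows "(\<integral>\<^sup>+y\<in>E. gauss_kernel r (x - y) \<partial>lborel) \<le> ennreal ((2 * pi)\<^sup>2 * sqrt (pi / r) * L)"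
proof -
  let ?k = "\<lambda>i a. ennreal (gauss_kernel r (x $ i - a))"
  have mass: "(\<integral>\<^sup>+a. ?k i a \<partial>lborel) = ennreal (2 * pi)" for i
    using nn_integral_gauss_kernel[OF r, of "x $ i"] by (simp add: gauss_kernel_commute[of r "x $ i"])
  have "(\<integral>\<^sup>+y\<in>E. gauss_kernel r (x - y) \<partial>lborel)
     = (\<integral>\<^sup>+a. \<integral>\<^sup>+b. \<integral>\<^sup>+c. ennreal (gauss_kernel r (x - vector [a, b, c])) * indicator E (vector [a, b, c] :: real^3) \<partial>lborel \<partial>lborel \<partial>lborel)"
    by (rule nn_integral_real3) measurable
  also have "\<dots> \<le> (\<integral>\<^sup>+a. \<integral>\<^sup>+b. ?k 1 a * (?k 2 b * ennreal (sqrt (pi / r) * L)) \<partial>lborel \<partial>lborel)"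
  proof (intro nn_integral_mono)
    fix a b
    have [measurable]: "{c. vector [a, b, c] \<in> E} \<in> sets borel"
      by measurable
    have "(\<integral>\<^sup>+c. ennreal (gauss_kernel r (x - vector [a, b, c])) * indicator E (vector [a, b, c] :: real^3) \<partial>lborel)
       \<le> (\<integral>\<^sup>+c. (?k 1 a * (?k 2 b * ennreal (sqrt (pi / r)))) * indicator {c. vector [a, b, c] \<in> E} c \<partial>lborel)"
    proof (rule nn_integral_mono)
      fix c
      have "gauss_kernel r (x$3 - c) \<le> sqrt (pi / r)"
        using gauss_kernel_le[OF r, of "x$3 - c"] by simp
      then have "ennreal (gauss_kernel r (x - vector [a, b, c])) \<le> ?k 1 a * (?k 2 b * ennreal (sqrt (pi / r)))"
        using r by (auto simp: gauss_kernel_vector mult_left_mono simp flip: ennreal_mult intro!: ennreal_leI)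
      then show "ennreal (gauss_kernel r (x - vector [a, b, c])) * indicator E (vector [a, b, c] :: real^3)
        \<le> (?k 1 a * (?k 2 b * ennreal (sqrt (pi / r)))) * indicator {c. vector [a, b, c] \<in> E} c"
        by (auto simp: indicator_def)
    qed
    also have "\<dots> = (?k 1 a * (?k 2 b * ennreal (sqrt (pi / r)))) * emeasure lborel {c. vector [a, b, c] \<in> E}"
      by (simp add: nn_integral_cmult_indicator)
    also have "\<dots> \<le> (?k 1 a * (?k 2 b * ennreal (sqrt (pi / r)))) * ennreal L"
      by (intro mult_left_mono L) simp
    also have "\<dots> = ?k 1 a * (?k 2 b * ennreal (sqrt (pi / r) * L))"
      using r L by (simp add: ennreal_mult mult.assoc)
    finally show "(\<integral>\<^sup>+c. ennreal (gauss_kernel r (x - vector [a, b, c])) * indicator E (vector [a, b, c] :: real^3) \<partial>lborel) \<le> \<dots>" .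
  qed
  also have "\<dots> = (\<integral>\<^sup>+a. ?k 1 a \<partial>lborel) * ((\<integral>\<^sup>+b. ?k 2 b \<partial>lborel) * ennreal (sqrt (pi / r) * L))"
    by (simp add: nn_integral_cmult nn_integral_multc)
  also have "\<dots> = ennreal (2 * pi) * (ennreal (2 * pi) * ennreal (sqrt (pi / r) * L))"
    by (simp only: mass)
  also have "\<dots> = ennreal ((2 * pi)\<^sup>2 * sqrt (pi / r) * L)"
    using r L by (simp add: power2_eq_square mult_ac flip: ennreal_mult)
  finally show ?thesis .
qed

text \<open>
  Boxes whose second and third coordinates are displaced by functions of the preceding ones. Shearing
  preserves the volume, so the neighbourhoods of curves that are needed have explicit measures.
\<close>

definition sheared_box :: "(real \<Rightarrow> real) \<Rightarrow> (real \<Rightarrow> real \<Rightarrow> real) \<Rightarrow> real \<Rightarrow> real \<Rightarrow> real \<Rightarrow> real \<Rightarrow> (real^3) set" where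
  "sheared_box f h l u A B =
     {x. x$1 \<in> {l..u} \<and> \<bar>x$2 - f (x$1)\<bar> \<le> A \<and> \<bar>x$3 - h (x$1) (x$2)\<bar> \<le> B}"

lemma emeasure_sheared_box:
  assumes f: "continuous_on UNIV f" and h: "continuous_on UNIV (\<lambda>(a, b). h a b)"
    and "l \<le> u" "0 \<le> A" "0 \<le> B"
  shows "sheared_box f h l u A B \<in> sets borel"
    and "emeasure lborel (sheared_box f h l u A B) = ennreal ((u - l) * (2 * A) * (2 * B))"
proof -
  have [measurable]: "f \<in> borel_measurable borel"
    using f by (rule borel_measurable_continuous_onI)
  have [measurable]: "case_prod h \<in> borel_measurable (borel \<Otimes>\<^sub>M borel)"
    unfolding borel_prod using h by (intro borel_measurable_continuous_onI) simp
  let ?S = "sheared_box f h l u A B"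
  show S [measurable]: "?S \<in> sets borel"
    unfolding sheared_box_def by measurable
  have "emeasure lborel ?S = (\<integral>\<^sup>+x. indicator ?S x \<partial>lborel)"
    by simp
  also have "\<dots> = (\<integral>\<^sup>+a. \<integral>\<^sup>+b. \<integral>\<^sup>+c. indicator ?S (vector [a, b, c] :: real^3) \<partial>lborel \<partial>lborel \<partial>lborel)"
    by (rule nn_integral_real3) measurable
  also have "\<dots> = (\<integral>\<^sup>+a. \<integral>\<^sup>+b. \<integral>\<^sup>+c. indicator {l..u} a * (indicator {f a - A..f a + A} b * indicator {h a b - B..h a b + B} c)
      \<partial>lborel \<partial>lborel \<partial>lborel)"
    by (intro nn_integral_cong) (auto simp: sheared_box_def indicator_def abs_le_iff)
  also have "\<dots> = (\<integral>\<^sup>+a. indicator {l..u} a * (ennreal (2 * A) * ennreal (2 * B)) \<partial>lborel)"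
  proof (rule nn_integral_cong)
    fix a
    have "(\<integral>\<^sup>+b. \<integral>\<^sup>+c. indicator {l..u} a * (indicator {f a - A..f a + A} b * indicator {h a b - B..h a b + B} c) \<partial>lborel \<partial>lborel)
       = (\<integral>\<^sup>+b. indicator {l..u} a * (indicator {f a - A..f a + A} b * ennreal (2 * B)) \<partial>lborel)"
      using assms(5) by (intro nn_integral_cong) (simp add: nn_integral_cmult mult.assoc[symmetric])
    also have "\<dots> = indicator {l..u} a * (ennreal (2 * A) * ennreal (2 * B))"
      using assms(4) by (simp add: nn_integral_cmult nn_integral_multc)
    finally show "(\<integral>\<^sup>+b. \<integral>\<^sup>+c. indicator {l..u} a * (indicator {f a - A..f a + A} b * indicator {h a b - B..h a b + B} c) \<partial>lborel \<partial>lborel) = \<dots>" .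
  qed
  also have "\<dots> = ennreal ((u - l) * (2 * A) * (2 * B))"
    using assms(3-5) by (simp add: nn_integral_multc mult.assoc flip: ennreal_mult)
  finally show "emeasure lborel ?S = ennreal ((u - l) * (2 * A) * (2 * B))" .
qed

text \<open>
  The set is a continuous image of a box.
\<close>

lemma compact_sheared_box:
  assumes f: "continuous_on UNIV f" and h: "continuous_on UNIV (\<lambda>(a, b). h a b)"
  shows "compact (sheared_box f h l u A B)"
proof -
  let ?\<Phi> = "\<lambda>x::real^3. vector [x$1, f (x$1) + x$2, h (x$1) (f (x$1) + x$2) + x$3] :: real^3"
  have fc: "continuous_on UNIV (\<lambda>x::real^3. f (x$1))"
    by (rule continuous_on_compose2[OF f]) (auto intro: continuous_intros)
  have hc: "continuous_on UNIV (\<lambda>x::real^3. h (x$1) (f (x$1) + x$2))"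
  proof -
    have "continuous_on UNIV (\<lambda>x::real^3. (x$1, f (x$1) + x$2))"
      by (intro continuous_intros fc)
    from continuous_on_compose2[OF h this] show ?thesis by simp
  qed
  have "continuous_on UNIV ?\<Phi>"
    by (intro continuous_on_vector3 continuous_intros fc hc)
  from compact_continuous_image[OF continuous_on_subset[OF this subset_UNIV] compact_cbox]
  have "compact (?\<Phi> ` cbox (vector [l, - A, - B]) (vector [u, A, B]))" .
  also have "?\<Phi> ` cbox (vector [l, - A, - B]) (vector [u, A, B]) = sheared_box f h l u A B"
  proof (intro set_eqI iffI)
    fix x assume x: "x \<in> sheared_box f h l u A B"
    let ?y = "vector [x$1, x$2 - f (x$1), x$3 - h (x$1) (x$2)] :: real^3"
    have "?\<Phi> ?y = x" by (simp add: vec_eq_iff forall_3)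
    moreover have "?y \<in> cbox (vector [l, - A, - B]) (vector [u, A, B])"
      using x unfolding sheared_box_def by (simp add: mem_box_cart forall_3 abs_le_iff)
    ultimately show "x \<in> ?\<Phi> ` cbox (vector [l, - A, - B]) (vector [u, A, B])"
      by (rule image_eqI[OF sym])
  next
    fix x assume "x \<in> ?\<Phi> ` cbox (vector [l, - A, - B]) (vector [u, A, B])"
    then obtain y where y: "y \<in> cbox (vector [l, - A, - B]) (vector [u, A, B])" and x: "x = ?\<Phi> y"
      by blast
    have "y$1 \<in> {l..u}" "\<bar>y$2\<bar> \<le> A" "\<bar>y$3\<bar> \<le> B"
      using y by (simp_all add: mem_box_cart forall_3 abs_le_iff)
    then show "x \<in> sheared_box f h l u A B"
      unfolding x sheared_box_def by simp
  qed
  finally show ?thesis .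
qed

lemma open_sheared_box:
  assumes f: "continuous_on UNIV f" and h: "continuous_on UNIV (\<lambda>(a, b). h a b)"
  shows "open {x::real^3. x$1 \<in> {l<..<u} \<and> \<bar>x$2 - f (x$1)\<bar> < A \<and> \<bar>x$3 - h (x$1) (x$2)\<bar> < B}"
proof -
  have fc: "continuous_on UNIV (\<lambda>x::real^3. f (x$1))"
    by (rule continuous_on_compose2[OF f]) (auto intro: continuous_intros)
  have hc: "continuous_on UNIV (\<lambda>x::real^3. h (x$1) (x$2))"
  proof -
    have "continuous_on UNIV (\<lambda>x::real^3. (x$1, x$2))"
      by (intro continuous_intros)
    from continuous_on_compose2[OF h this] show ?thesis by simp
  qed
  show ?thesis unfolding greaterThanLessThan_iff
    by (intro open_Collect_conj open_Collect_less continuous_intros fc hc)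
qed

section \<open>Smooth curves and their averages\<close>

lemma smooth_real_derivative:
  assumes "smooth_real f"
  shows "((deriv ^^ n) f has_real_derivative (deriv ^^ Suc n) f t) (at t)"
  using assms by (simp add: smooth_real_def DERIV_deriv_iff_real_differentiable)

lemma smooth_real_continuous:
  assumes "smooth_real f"
  shows "continuous_on S ((deriv ^^ n) f)"
  using smooth_real_derivative[OF assms] by (meson DERIV_isCont continuous_at_imp_continuous_on)

lemma smooth_real_bounds:
  assumes "smooth_real f"
  obtains L where "L \<ge> 0" "\<And>t. t \<in> {a..b} \<Longrightarrow> \<bar>f t\<bar> \<le> L" "\<And>t. t \<in> {a..b} \<Longrightarrow> \<bar>deriv f t\<bar> \<le> L"
    "\<And>t t'. t \<in> {a..b} \<Longrightarrow> t' \<in> {a..b} \<Longrightarrow> \<bar>f t - f t'\<bar> \<le> L * \<bar>t - t'\<bar>"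
proof -
  have bdd: "\<exists>C. \<forall>t\<in>{a..b}. \<bar>(deriv ^^ n) f t\<bar> \<le> C" for n
    using compact_continuous_image[OF smooth_real_continuous[OF assms, of "{a..b}" n] compact_Icc]
    by (force dest: compact_imp_bounded simp: bounded_iff)
  obtain C D where "\<forall>t\<in>{a..b}. \<bar>f t\<bar> \<le> C" "\<forall>t\<in>{a..b}. \<bar>deriv f t\<bar> \<le> D"
    using bdd[of 0] bdd[of 1] by auto
  then have L: "\<And>t. t \<in> {a..b} \<Longrightarrow> \<bar>f t\<bar> \<le> max 0 (max C D)" "\<And>t. t \<in> {a..b} \<Longrightarrow> \<bar>deriv f t\<bar> \<le> max 0 (max C D)"
    by (auto simp: le_max_iff_disj)
  have "\<bar>f t - f t'\<bar> \<le> max 0 (max C D) * \<bar>t - t'\<bar>" if "t \<in> {a..b}" "t' \<in> {a..b}" for t t'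
  proof -
    have "norm (f t - f t') \<le> max 0 (max C D) * norm (t - t')"
    proof (rule field_differentiable_bound[of "{a..b}" f "deriv f"])
      show "(f has_field_derivative deriv f z) (at z within {a..b})" for z
        using smooth_real_derivative[OF assms, of 0 z] by (simp add: has_field_derivative_at_within)
    qed (use that L in auto)
    then show ?thesis by simp
  qed
  then show ?thesis using L by (intro that[of "max 0 (max C D)"]) auto
qed

text \<open>
  Divided by the square of \<open>f''\<close>, the hypothesis says that \<open>g''/f''\<close> has derivative \<open>1/2\<close>, so
  \<open>g''/f'' - t/2\<close> is a constant \<open>c\<close>. Integrating \<open>g'' = (t/2 + c) f''\<close> by parts gives \<open>c'\<close>.
\<close>

lemma contact_constants:
  fixes f g :: "real \<Rightarrow> real"
  assumes f: "smooth_real f" and g: "smooth_real g"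
    and nz: "\<And>t. t \<in> {0..1} \<Longrightarrow> (deriv ^^ 2) f t \<noteq> 0"
    and det: "\<And>t. t \<in> {0..1} \<Longrightarrow>
       (deriv ^^ 2) f t * (deriv ^^ 3) g t - (deriv ^^ 2) g t * (deriv ^^ 3) f t = 1/2 * ((deriv ^^ 2) f t)\<^sup>2"
  obtains c c' where "\<forall>t\<in>{0..1}. deriv g t = (t / 2 + c) * deriv f t - f t / 2 + c'"
proof -
  note [derivative_intros] = smooth_real_derivative[OF f, of 0, simplified] smooth_real_derivative[OF f, of 1, simplified]
    smooth_real_derivative[OF g, of 1, simplified]
  have f2: "((deriv ^^ 2) f has_real_derivative (deriv ^^ 3) f t) (at t)"
    and g2: "((deriv ^^ 2) g has_real_derivative (deriv ^^ 3) g t) (at t)" for t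
    using smooth_real_derivative[OF f, of 2 t] smooth_real_derivative[OF g, of 2 t] by (simp_all add: eval_nat_numeral)
  have "\<exists>c. \<forall>t\<in>{0..1}. (deriv ^^ 2) g t / (deriv ^^ 2) f t - t / 2 = c"
  proof (rule has_field_derivative_zero_constant)
    fix t :: real assume t: "t \<in> {0..1}"
    have "((\<lambda>t. (deriv ^^ 2) g t / (deriv ^^ 2) f t - t / 2) has_real_derivative 0) (at t)"
      using nz[OF t] det[OF t]
      by (auto intro!: derivative_eq_intros f2 g2 simp: field_simps power2_eq_square)
    then show "((\<lambda>t. (deriv ^^ 2) g t / (deriv ^^ 2) f t - t / 2) has_real_derivative 0) (at t within {0..1})"
      by (rule has_field_derivative_at_within)
  qed simp
  then obtain c where "\<And>t. t \<in> {0..1} \<Longrightarrow> (deriv ^^ 2) g t / (deriv ^^ 2) f t - t / 2 = c" by blast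
  then have c: "deriv (deriv g) t = (t / 2 + c) * deriv (deriv f) t" if "t \<in> {0..1}" for t
    using that nz[OF that] by (force simp: eval_nat_numeral field_simps)
  have "\<exists>c'. \<forall>t\<in>{0..1}. deriv g t - (t / 2 + c) * deriv f t + f t / 2 = c'"
  proof (rule has_field_derivative_zero_constant)
    fix t :: real assume t: "t \<in> {0..1}"
    have "((\<lambda>t. deriv g t - (t / 2 + c) * deriv f t + f t / 2) has_real_derivative 0) (at t)"
      using c[OF t] by (auto intro!: derivative_eq_intros simp: field_simps)
    then show "((\<lambda>t. deriv g t - (t / 2 + c) * deriv f t + f t / 2) has_real_derivative 0) (at t within {0..1})"
      by (rule has_field_derivative_at_within)
  qed simp
  then obtain c' where "\<And>t. t \<in> {0..1} \<Longrightarrow> deriv g t - (t / 2 + c) * deriv f t + f t / 2 = c'" by blast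
  then have "\<forall>t\<in>{0..1}. deriv g t = (t / 2 + c) * deriv f t - f t / 2 + c'"
    by (force simp: algebra_simps)
  then show ?thesis by (rule that)
qed

lemma exists_interval_density_lower_bound:
  fixes \<eta> :: "real \<Rightarrow> real"
  assumes "continuous_on UNIV \<eta>" "\<And>t. \<eta> t \<ge> 0" "closure {t. \<eta> t \<noteq> 0} \<subseteq> {0..1}"
    and "density lborel (\<lambda>t. ennreal (\<eta> t)) \<noteq> null_measure lborel"
  obtains l u m where "l < u" "m > 0" "0 \<le> l" "u \<le> 1" "\<And>t. t \<in> {l..u} \<Longrightarrow> m \<le> \<eta> t"
proof -
  have "\<exists>t. \<eta> t \<noteq> 0"
  proof (rule ccontr)
    assume "\<nexists>t. \<eta> t \<noteq> 0"
    then have "density lborel (\<lambda>t. ennreal (\<eta> t)) = null_measure lborel"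
      by (intro measure_eqI) (auto simp: emeasure_density)
    then show False using assms(4) by simp
  qed
  then obtain t0 where t0: "\<eta> t0 > 0" using assms(2) by (metis order_le_less)
  have "isCont \<eta> t0" using assms(1) by (simp add: continuous_on_eq_continuous_at)
  then obtain d where d: "d > 0" "\<And>t. \<bar>t - t0\<bar> < d \<Longrightarrow> \<bar>\<eta> t - \<eta> t0\<bar> < \<eta> t0 / 2"
    using t0 unfolding continuous_at_eps_delta dist_real_def by (metis half_gt_zero)
  have lower: "\<eta> t0 / 2 \<le> \<eta> t" if "t \<in> {t0 - d / 2..t0 + d / 2}" for t
  proof -
    have "\<bar>t - t0\<bar> < d" using that d(1) by (auto simp: abs_less_iff)
    from d(2)[OF this] show ?thesis unfolding abs_less_iff by linarith
  qed
  have "t \<in> {0..1}" if "t \<in> {t0 - d / 2..t0 + d / 2}" for t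
    using lower[OF that] t0 assms(3) closure_subset[of "{t. \<eta> t \<noteq> 0}"] by force
  from this[of "t0 - d / 2"] this[of "t0 + d / 2"] lower t0 d(1) show ?thesis
    by (intro that[of "t0 - d / 2" "t0 + d / 2" "\<eta> t0 / 2"]) auto
qed

lemma heis_mult_measurable [measurable]:
  assumes [measurable]: "f \<in> borel_measurable M" "g \<in> borel_measurable M"
  shows "(\<lambda>p. f p \<odot> g p) \<in> borel_measurable M"
proof -
  have "continuous_on UNIV (\<lambda>p. fst p \<odot> snd p)"
    unfolding heis_mult_def by (intro continuous_on_vector3 continuous_intros) auto
  then have [measurable]: "(\<lambda>p. fst p \<odot> snd p) \<in> borel_measurable (borel \<Otimes>\<^sub>M borel)"
    unfolding borel_prod by (rule borel_measurable_continuous_onI)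
  have "(\<lambda>p. (f p, g p)) \<in> M \<rightarrow>\<^sub>M borel \<Otimes>\<^sub>M borel"
    by measurable
  from measurable_compose[OF this, of "\<lambda>p. fst p \<odot> snd p"] show ?thesis by simp
qed

text \<open>
  The average of the indicator of \<open>F\<close> at \<open>x\<close> is the measure of the set of times at which the curve
  \<open>\<gamma>(t)\<^sup>-\<^sup>1 \<odot> x\<close> lies in \<open>F\<close>. It is bounded below once this set contains an interval on which the
  density is bounded below.
\<close>

lemma heis_average_indicator:
  fixes \<eta> :: "real \<Rightarrow> real" and \<gamma> :: "real \<Rightarrow> real^3"
  assumes \<eta>: "continuous_on UNIV \<eta>" "\<And>t. \<eta> t \<ge> 0" "closure {t. \<eta> t \<noteq> 0} \<subseteq> {0..1}"
    and \<mu>: "\<mu> = density lborel (\<lambda>t. ennreal (\<eta> t))"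
    and [measurable]: "\<gamma> \<in> borel_measurable borel" "F \<in> sets borel"
  obtains v where "v \<in> borel_measurable borel" "\<And>x. 0 \<le> v x" "\<And>x. v x \<le> measure \<mu> UNIV"
    "\<And>x. heis_average \<gamma> \<mu> (\<lambda>x. of_real (indicator F x)) x = of_real (v x)"
    "\<And>x a b m. a \<le> b \<Longrightarrow> m \<ge> 0 \<Longrightarrow> (\<And>t. t \<in> {a..b} \<Longrightarrow> m \<le> \<eta> t) \<Longrightarrow>
        (\<And>t. t \<in> {a..b} \<Longrightarrow> heis_inv (\<gamma> t) \<odot> x \<in> F) \<Longrightarrow> m * (b - a) \<le> v x"
proof -
  have [measurable]: "\<eta> \<in> borel_measurable borel"
    using \<eta>(1) by (rule borel_measurable_continuous_onI)
  have sets_\<mu> [measurable_cong]: "sets \<mu> = sets borel" and sp: "space \<mu> = UNIV"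
    by (simp_all add: \<mu>)
  obtain C where C: "\<And>t. t \<in> {0..1} \<Longrightarrow> \<bar>\<eta> t\<bar> \<le> C"
    using compact_continuous_image[OF continuous_on_subset[OF \<eta>(1)] compact_Icc[of 0 1]]
    by (force dest!: compact_imp_bounded simp: bounded_iff)
  have "emeasure \<mu> UNIV = (\<integral>\<^sup>+t. \<eta> t \<partial>lborel)"
    by (simp add: \<mu> emeasure_density)
  also have "\<dots> \<le> (\<integral>\<^sup>+t. ennreal C * indicator {0..1::real} t \<partial>lborel)"
  proof (rule nn_integral_mono)
    fix t
    show "ennreal (\<eta> t) \<le> ennreal C * indicator {0..1} t"
    proof (cases "t \<in> {0..1}")
      case True
      then show ?thesis using C[OF True] by (simp add: ennreal_leI)
    next
      case False
      then have "\<eta> t = 0" using \<eta>(3) closure_subset[of "{t. \<eta> t \<noteq> 0}"] by blast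
      then show ?thesis by simp
    qed
  qed
  also have "\<dots> < \<infinity>" by (simp add: nn_integral_cmult_indicator ennreal_mult_less_top)
  finally have fin: "emeasure \<mu> (space \<mu>) \<noteq> \<infinity>" by (simp add: sp)
  interpret finite_measure \<mu>
    by (rule finite_measureI) (rule fin)
  have act [measurable]: "(\<lambda>(x, t). heis_inv (\<gamma> t) \<odot> x) \<in> borel_measurable (borel \<Otimes>\<^sub>M \<mu>)"
    unfolding heis_inv_def by measurable
  have set: "{t. heis_inv (\<gamma> t) \<odot> x \<in> F} \<in> sets \<mu>" for x
  proof -
    have [measurable]: "(\<lambda>t. heis_inv (\<gamma> t) \<odot> x) \<in> borel_measurable borel"
      unfolding heis_inv_def by measurable
    show ?thesis unfolding sets_\<mu> by measurable
  qed
  define v where "v x = measure \<mu> {t. heis_inv (\<gamma> t) \<odot> x \<in> F}" for x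
  have v_int: "v x = (\<integral>t. indicator F (heis_inv (\<gamma> t) \<odot> x) \<partial>\<mu>)" for x
  proof -
    have "v x = (\<integral>t. indicator {t. heis_inv (\<gamma> t) \<odot> x \<in> F} t \<partial>\<mu>)"
      using set by (simp add: v_def sp)
    then show ?thesis by (simp add: indicator_def)
  qed
  show ?thesis
  proof (rule that[of v])
    have "(\<lambda>x. \<integral>t. (indicator F (heis_inv (\<gamma> t) \<odot> x) :: real) \<partial>\<mu>) \<in> borel_measurable borel"
      by measurable
    then show "v \<in> borel_measurable borel"
      by (simp add: v_int[abs_def])
    show "0 \<le> v x" for x by (simp add: v_def)
    show "v x \<le> measure \<mu> UNIV" for x
      unfolding v_def by (rule finite_measure_mono) (auto simp: sets_\<mu>)
    show "heis_average \<gamma> \<mu> (\<lambda>x. of_real (indicator F x)) x = of_real (v x)" for x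
      unfolding heis_average_def v_int by simp
    fix x a b m
    assume ab: "a \<le> b" and m: "m \<ge> 0" "\<And>t. t \<in> {a..b} \<Longrightarrow> m \<le> \<eta> t"
      and F: "\<And>t. t \<in> {a..b} \<Longrightarrow> heis_inv (\<gamma> t) \<odot> x \<in> F"
    have "ennreal (m * (b - a)) = (\<integral>\<^sup>+t. ennreal m * indicator {a..b} t \<partial>lborel)"
      using ab m by (simp add: nn_integral_cmult_indicator ennreal_mult)
    also have "\<dots> \<le> (\<integral>\<^sup>+t. ennreal (\<eta> t) * indicator {a..b} t \<partial>lborel)"
      using m by (intro nn_integral_mono) (auto simp: indicator_def ennreal_leI)
    also have "\<dots> = emeasure \<mu> {a..b}"
      by (simp add: \<mu> emeasure_density)
    also have "\<dots> \<le> emeasure \<mu> {t. heis_inv (\<gamma> t) \<odot> x \<in> F}"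
      using F set by (intro emeasure_mono) auto
    also have "\<dots> = ennreal (v x)"
      by (simp add: v_def emeasure_eq_measure)
    finally show "m * (b - a) \<le> v x"
      by (simp add: v_def)
  qed
qed

section \<open>The two families of test sets\<close>

locale curve_average =
  fixes \<gamma> :: "real \<Rightarrow> real^3" and \<gamma>\<^sub>2 \<gamma>\<^sub>3 \<eta> :: "real \<Rightarrow> real" and \<mu> :: "real measure"
  assumes curve: "\<And>t. \<gamma> t = vector [t, \<gamma>\<^sub>2 t, \<gamma>\<^sub>3 t]"
    and smooth: "smooth_real \<gamma>\<^sub>2" "smooth_real \<gamma>\<^sub>3"
    and density: "continuous_on UNIV \<eta>" "\<And>t. \<eta> t \<ge> 0" "closure {t. \<eta> t \<noteq> 0} \<subseteq> {0..1}"
    and \<mu>: "\<mu> = density lborel (\<lambda>t. ennreal (\<eta> t))" and \<mu>_nonzero: "\<mu> \<noteq> null_measure lborel"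
begin

lemma continuous_components: "continuous_on S \<gamma>\<^sub>2" "continuous_on S \<gamma>\<^sub>3"
  using smooth_real_continuous[OF smooth(1), of S 0] smooth_real_continuous[OF smooth(2), of S 0] by simp_all

lemma curve_measurable [measurable]: "\<gamma> \<in> borel_measurable borel"
proof -
  have "continuous_on UNIV \<gamma>"
    unfolding curve[abs_def] by (intro continuous_on_vector3 continuous_components continuous_on_id)
  then show ?thesis by (rule borel_measurable_continuous_onI)
qed

lemma translate_components:
  "(heis_inv (\<gamma> t) \<odot> x) $ 1 = x$1 - t"
  "(heis_inv (\<gamma> t) \<odot> x) $ 2 = x$2 - \<gamma>\<^sub>2 t"
  "(heis_inv (\<gamma> t) \<odot> x) $ 3 = x$3 - \<gamma>\<^sub>3 t + (\<gamma>\<^sub>2 t * x$1 - t * x$2) / 2"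
  by (simp_all add: heis_mult_def heis_inv_def curve)

text \<open>
  Here \<open>E\<close> is a cube of side \<open>2 \<delta>\<close> around the origin. Since the translates \<open>\<gamma>(t)\<^sup>-\<^sup>1 \<odot> x\<close> of points
  \<open>x\<close> of size \<open>\<delta>\<close> lie within \<open>O(\<delta>)\<close> of \<open>\<gamma>(t)\<^sup>-\<^sup>1\<close>, the average of the indicator of a
  \<open>\<delta>\<close>-neighbourhood \<open>F\<close> of the inverse curve does not become small on \<open>E\<close>. The cube is thin in all three
  directions, which allows \<open>b\<close> up to \<open>3/2\<close>.
\<close>

lemma curve_neighbourhood_exponent_bound:
  assumes bdd: "bounded_Lp_comp_to_sobolev p s (heis_average \<gamma> \<mu>)" and p: "1 < p" and s: "0 < s"
    and b: "0 \<le> b" "b < p * s / 2" "b \<le> 3 / 2"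
  shows "b \<le> 1 / 2"
proof -
  obtain l u m where lu: "l < u" "m > 0" "0 \<le> l" "u \<le> 1" and m: "\<And>t. t \<in> {l..u} \<Longrightarrow> m \<le> \<eta> t"
    using exists_interval_density_lower_bound[OF density \<mu>_nonzero[unfolded \<mu>]] by blast
  \<comment> \<open>the interval \<open>{-3..3}\<close> contains all times \<open>t\<close> and \<open>t - x\<^sub>1\<close> that occur\<close>
  obtain L2 where L2: "L2 \<ge> 0" "\<And>t. t \<in> {-3..3} \<Longrightarrow> \<bar>\<gamma>\<^sub>2 t\<bar> \<le> L2"
     "\<And>t t'. t \<in> {-3..3} \<Longrightarrow> t' \<in> {-3..3} \<Longrightarrow> \<bar>\<gamma>\<^sub>2 t - \<gamma>\<^sub>2 t'\<bar> \<le> L2 * \<bar>t - t'\<bar>"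
    by (rule smooth_real_bounds[OF smooth(1), of "-3" 3]) blast
  obtain L3 where L3: "L3 \<ge> 0"
     "\<And>t t'. t \<in> {-3..3} \<Longrightarrow> t' \<in> {-3..3} \<Longrightarrow> \<bar>\<gamma>\<^sub>3 t - \<gamma>\<^sub>3 t'\<bar> \<le> L3 * \<bar>t - t'\<bar>"
    by (rule smooth_real_bounds[OF smooth(2), of "-3" 3]) blast
  define B where "B = 3 + 3 * L2 + 2 * L3"
  have B: "B > 0" using L2(1) L3(1) by (simp add: B_def)
  let ?f = "\<lambda>a. - \<gamma>\<^sub>2 (- a)" and ?h = "\<lambda>a b::real. - \<gamma>\<^sub>3 (- a)"
  have fc: "continuous_on UNIV ?f"
    by (intro continuous_intros continuous_on_compose2[OF continuous_components(1)[of UNIV]]) auto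
  have hc: "continuous_on UNIV (\<lambda>(a, b). ?h a b)"
    unfolding case_prod_beta
    by (intro continuous_intros continuous_on_compose2[OF continuous_components(2)[of UNIV]]) auto
  define F where "F \<delta> = sheared_box ?f ?h (-2) 2 (B * \<delta>) (B * \<delta>)" for \<delta>
  have K: "compact (F 1)" unfolding F_def by (rule compact_sheared_box[OF fc hc])
  define C0 where "C0 = (2 * pi) ^ 3 + 8 * sqrt pi ^ 3"
  have C0: "C0 > 0" by (simp add: C0_def add_pos_pos)
  define E where "E \<delta> = sheared_box (\<lambda>_. 0) (\<lambda>_ _. 0) (- \<delta>) \<delta> \<delta> \<delta>" for \<delta>
  have F: "F \<delta> \<in> sets borel" "emeasure lborel (F \<delta>) = ennreal (16 * B\<^sup>2 * \<delta>\<^sup>2)" "F \<delta> \<subseteq> F 1"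
    if \<delta>: "0 < \<delta>" "\<delta> \<le> 1 / 2" for \<delta>
  proof -
    show "F \<delta> \<in> sets borel" "emeasure lborel (F \<delta>) = ennreal (16 * B\<^sup>2 * \<delta>\<^sup>2)"
      using emeasure_sheared_box[OF fc hc, of "-2" 2 "B * \<delta>" "B * \<delta>"] \<delta> B
      by (simp_all add: F_def power2_eq_square mult_ac)
    show "F \<delta> \<subseteq> F 1"
    proof
      fix x assume "x \<in> F \<delta>"
      moreover have "B * \<delta> \<le> B * 1" using \<delta> B by (intro mult_left_mono) auto
      ultimately show "x \<in> F 1" by (auto simp: F_def sheared_box_def)
    qed
  qed
  have E: "E \<delta> \<in> sets borel" "emeasure lborel (E \<delta>) = ennreal (8 * \<delta> ^ 3)" "compact (E \<delta>)"
    if \<delta>: "0 < \<delta>" for \<delta>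
  proof -
    show "E \<delta> \<in> sets borel" "emeasure lborel (E \<delta>) = ennreal (8 * \<delta> ^ 3)"
      using emeasure_sheared_box[of "\<lambda>_. 0" "\<lambda>_ _. 0" "- \<delta>" \<delta> \<delta> \<delta>] \<delta>
      by (simp_all add: E_def power3_eq_cube mult_ac case_prod_beta)
    show "compact (E \<delta>)" unfolding E_def by (rule compact_sheared_box) (auto simp: case_prod_beta)
  qed
  have average: "\<exists>v E'. v \<in> borel_measurable borel \<and> (\<forall>x. 0 \<le> v x \<and> v x \<le> measure \<mu> UNIV) \<and>
      (\<forall>x. heis_average \<gamma> \<mu> (\<lambda>x. of_real (indicator (F \<delta>) x)) x = of_real (v x)) \<and>
      open E' \<and> E \<delta> \<subseteq> E' \<and> (\<forall>x\<in>E'. m * (u - l) * \<delta> ^ 0 \<le> v x)"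
    if \<delta>: "0 < \<delta>" "\<delta> \<le> 1 / 2" for \<delta>
  proof -
    define E' where "E' = {x::real^3. x$1 \<in> {- (2*\<delta>)<..<2*\<delta>} \<and> \<bar>x$2 - 0\<bar> < 2 * \<delta> \<and> \<bar>x$3 - 0\<bar> < 2 * \<delta>}"
    obtain v where v: "v \<in> borel_measurable borel" "\<And>x. 0 \<le> v x" "\<And>x. v x \<le> measure \<mu> UNIV"
      "\<And>x. heis_average \<gamma> \<mu> (\<lambda>x. of_real (indicator (F \<delta>) x)) x = of_real (v x)"
      and v_lower: "\<And>x a b m. a \<le> b \<Longrightarrow> m \<ge> 0 \<Longrightarrow> (\<And>t. t \<in> {a..b} \<Longrightarrow> m \<le> \<eta> t) \<Longrightarrow>
        (\<And>t. t \<in> {a..b} \<Longrightarrow> heis_inv (\<gamma> t) \<odot> x \<in> F \<delta>) \<Longrightarrow> m * (b - a) \<le> v x"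
      by (rule heis_average_indicator[OF density \<mu> curve_measurable F(1)[OF \<delta>]]) blast
    have inF: "heis_inv (\<gamma> t) \<odot> x \<in> F \<delta>" if x: "x \<in> E'" and t: "t \<in> {l..u}" for x t
    proof -
      have t01: "0 \<le> t" "t \<le> 1" using t lu by auto
      have x': "\<bar>x$1\<bar> \<le> 2 * \<delta>" "\<bar>x$2\<bar> \<le> 2 * \<delta>" "\<bar>x$3\<bar> \<le> 2 * \<delta>"
        using x by (auto simp: E'_def abs_le_iff)
      have x1: "\<bar>x$1\<bar> \<le> 1" using x'(1) \<delta> by simp
      have tt: "t - x$1 \<in> {-3..3}" "t \<in> {-3..3}" using t01 x1 by (auto simp: abs_le_iff)
      have d2: "\<bar>\<gamma>\<^sub>2 (t - x$1) - \<gamma>\<^sub>2 t\<bar> \<le> L2 * (2 * \<delta>)"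
        using L2(3)[OF tt] x'(1) L2(1) by (smt (verit) mult_left_mono)
      have d3: "\<bar>\<gamma>\<^sub>3 (t - x$1) - \<gamma>\<^sub>3 t\<bar> \<le> L3 * (2 * \<delta>)"
        using L3(2)[OF tt] x'(1) L3(1) by (smt (verit) mult_left_mono)
      have p1: "\<bar>\<gamma>\<^sub>2 t * x$1\<bar> \<le> L2 * (2 * \<delta>)"
        unfolding abs_mult using L2(2)[OF tt(2)] x'(1) L2(1) by (intro mult_mono) auto
      have p2: "\<bar>t * x$2\<bar> \<le> 1 * (2 * \<delta>)"
        unfolding abs_mult using t01 x'(2) by (intro mult_mono) auto
      have "\<bar>x$2 - \<gamma>\<^sub>2 t + \<gamma>\<^sub>2 (t - x$1)\<bar> \<le> 2 * \<delta> + L2 * (2 * \<delta>)"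
        using d2 x'(2) by linarith
      also have "\<dots> \<le> B * \<delta>"
        using \<delta> L2(1) L3(1) by (simp add: B_def algebra_simps)
      finally have c2: "\<bar>x$2 - \<gamma>\<^sub>2 t + \<gamma>\<^sub>2 (t - x$1)\<bar> \<le> B * \<delta>" .
      have triangle: "\<bar>a + b + (c - d) / 2\<bar> \<le> a' + b' + (c' + d') / 2"
        if "\<bar>a\<bar> \<le> a'" "\<bar>b\<bar> \<le> b'" "\<bar>c\<bar> \<le> c'" "\<bar>d\<bar> \<le> d'" for a b c d a' b' c' d' :: real
        by (intro abs_leI)
          (use that[THEN abs_le_D1] that[THEN abs_le_D2] in \<open>simp_all add: field_simps\<close>)
      have "\<bar>x$3 - \<gamma>\<^sub>3 t + (\<gamma>\<^sub>2 t * x$1 - t * x$2) / 2 + \<gamma>\<^sub>3 (t - x$1)\<bar>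
          \<le> 2 * \<delta> + L3 * (2 * \<delta>) + (L2 * (2 * \<delta>) + 1 * (2 * \<delta>)) / 2"
        using triangle[OF x'(3) d3 p1 p2] by (simp add: algebra_simps)
      also have "\<dots> \<le> B * \<delta>"
        using \<delta> L2(1) L3(1) by (simp add: B_def algebra_simps)
      finally have c3: "\<bar>x$3 - \<gamma>\<^sub>3 t + (\<gamma>\<^sub>2 t * x$1 - t * x$2) / 2 + \<gamma>\<^sub>3 (t - x$1)\<bar> \<le> B * \<delta>" .
      show ?thesis
        unfolding F_def sheared_box_def mem_Collect_eq translate_components
        using c2 c3 t01 x1 by (auto simp: abs_le_iff)
    qed
    have "open E'"
      using open_sheared_box[of "\<lambda>_. 0" "\<lambda>_ _. 0" "- (2*\<delta>)" "2*\<delta>" "2*\<delta>" "2*\<delta>"]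
      unfolding E'_def by (simp add: case_prod_beta)
    moreover have "E \<delta> \<subseteq> E'" using \<delta> by (auto simp: E_def E'_def sheared_box_def)
    moreover have "m * (u - l) \<le> v x" if "x \<in> E'" for x
      using lu m inF[OF that] by (intro v_lower) auto
    ultimately show ?thesis
      using v by (intro exI[of _ v] exI[of _ E'] conjI allI ballI) simp_all
  qed
  have heat: "(\<integral>\<^sup>+y\<in>E \<delta>. gauss_kernel r (x - y) \<partial>lborel) \<le> ennreal (C0 * (\<delta>\<^sup>2 / r) powr b)"
    if \<delta>: "0 < \<delta>" and r: "0 < r" for \<delta> r x
    unfolding C0_def
  proof (rule min_le_powr_interpolation[where a = "3 / 2"])
    show "(\<integral>\<^sup>+y\<in>E \<delta>. gauss_kernel r (x - y) \<partial>lborel) \<le> ennreal ((2 * pi) ^ 3)"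
      using nn_integral_gauss_kernel_le[OF r, of x "E \<delta>"] by simp
    have "(\<integral>\<^sup>+y\<in>E \<delta>. gauss_kernel r (x - y) \<partial>lborel) \<le> ennreal (sqrt (pi / r) ^ 3) * ennreal (8 * \<delta> ^ 3)"
      using nn_integral_gauss_kernel_le_emeasure[OF r E(1)[OF \<delta>], of x] by (simp add: E(2)[OF \<delta>])
    also have "\<dots> = ennreal (sqrt (pi / r) ^ 3 * (8 * \<delta> ^ 3))"
      using r \<delta> by (simp add: ennreal_mult)
    also have "sqrt (pi / r) ^ 3 * (8 * \<delta> ^ 3) = 8 * sqrt pi ^ 3 * (\<delta>\<^sup>2 / r) powr (3 / 2)"
    proof -
      have "(\<delta>\<^sup>2 / r) powr (3 / 2) = ((\<delta>\<^sup>2 / r) powr (1 / 2)) powr 3"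
        by (simp add: powr_powr)
      also have "\<dots> = sqrt (\<delta>\<^sup>2 / r) ^ 3"
        using r \<delta> by (simp add: powr_half_sqrt powr_realpow[of _ 3, simplified])
      also have "\<dots> = \<delta> ^ 3 / sqrt r ^ 3"
        using r \<delta> by (simp add: real_sqrt_divide power_divide)
      finally show ?thesis
        unfolding real_sqrt_divide power_divide by simp
    qed
    finally show "(\<integral>\<^sup>+y\<in>E \<delta>. gauss_kernel r (x - y) \<partial>lborel) \<le> ennreal (8 * sqrt pi ^ 3 * (\<delta>\<^sup>2 / r) powr (3 / 2))" .
  qed (use r \<delta> b in auto)
  have "real 2 + real 2 * b \<le> p * real 0 + real 3"
  proof (rule test_family_exponents[OF bdd K p s b(1,2), where \<delta>\<^sub>0 = "1 / 2" and F = F and E = E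
          and w = "16 * B\<^sup>2" and e = 8 and \<alpha> = "m * (u - l)" and C\<^sub>0 = C0 and M = "measure \<mu> UNIV"])
    fix \<delta> :: real assume \<delta>: "0 < \<delta>" "\<delta> \<le> 1 / 2"
    show "F \<delta> \<in> sets borel \<and> F \<delta> \<subseteq> F 1 \<and> emeasure lborel (F \<delta>) \<le> ennreal (16 * B\<^sup>2 * \<delta>\<^sup>2)"
      using F[OF \<delta>] by simp
    show "compact (E \<delta>) \<and> measure lborel (E \<delta>) = 8 * \<delta> ^ 3"
      using E[OF \<delta>(1)] \<delta>(1) by (simp add: measure_def)
  qed (use average heat lu B C0 in simp_all)
  then show ?thesis by simp
qed

text \<open>
  The points \<open>x\<close> of the tube \<open>E\<close>, for \<open>t\<close> in an interval, are those for which \<open>\<gamma>(t)\<^sup>-\<^sup>1 \<odot> x\<close>, at the time \<open>t = x\<^sub>1 - 2 c\<close> when its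
  first coordinate is \<open>2 c\<close>, lies within \<open>\<delta>\<close> and \<open>\<delta>\<^sup>2\<close> of \<open>(2 c, -2 c', 0)\<close> in the second and third
  coordinates. At times \<open>\<tau>\<close> with \<open>|\<tau> - t| \<le> \<delta>\<close> the contact identity makes the velocity of the third coordinate
  \<open>O(\<delta>)\<close>, so this coordinate remains \<open>O(\<delta>\<^sup>2)\<close> and the curve stays in the box \<open>F\<close> during a time of
  order \<open>\<delta>\<close>.
\<close>

lemma horizontal_tube_exponent_bound:
  assumes bdd: "bounded_Lp_comp_to_sobolev p s (heis_average \<gamma> \<mu>)" and p: "1 < p" and s: "0 < s"
    and b: "0 \<le> b" "b < p * s / 2" "b \<le> 1 / 2"
    and contact: "\<And>t. t \<in> {0..1} \<Longrightarrow> deriv \<gamma>\<^sub>3 t = (t / 2 + c) * deriv \<gamma>\<^sub>2 t - \<gamma>\<^sub>2 t / 2 + c'"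
  shows "4 * b \<le> p - 1"
proof -
  obtain l u m where lu: "l < u" "m > 0" "0 \<le> l" "u \<le> 1" and m: "\<And>t. t \<in> {l..u} \<Longrightarrow> m \<le> \<eta> t"
    using exists_interval_density_lower_bound[OF density \<mu>_nonzero[unfolded \<mu>]] by blast
  \<comment> \<open>the tube is kept at distance \<open>d\<close> from the ends of \<open>{l..u}\<close>, to leave room for an open
    neighbourhood over \<open>{l<..<u}\<close>\<close>
  define d where "d = (u - l) / 4"
  have d: "d > 0" using lu by (simp add: d_def)
  obtain L where L: "L \<ge> 0" "\<And>t. t \<in> {0..1} \<Longrightarrow> \<bar>deriv \<gamma>\<^sub>2 t\<bar> \<le> L"
     "\<And>t t'. t \<in> {0..1} \<Longrightarrow> t' \<in> {0..1} \<Longrightarrow> \<bar>\<gamma>\<^sub>2 t - \<gamma>\<^sub>2 t'\<bar> \<le> L * \<bar>t - t'\<bar>"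
    by (rule smooth_real_bounds[OF smooth(1), of 0 1]) blast
  define B where "B = 3 + L"
  have B: "B > 0" using L(1) by (simp add: B_def)
  let ?f = "\<lambda>a. \<gamma>\<^sub>2 (a - 2 * c) - 2 * c'"
    and ?h = "\<lambda>a b. \<gamma>\<^sub>3 (a - 2 * c) - (\<gamma>\<^sub>2 (a - 2 * c) * a - (a - 2 * c) * b) / 2"
  have fc: "continuous_on UNIV ?f"
    by (intro continuous_intros continuous_on_compose2[OF continuous_components(1)[of UNIV]]) auto
  have hc: "continuous_on UNIV (\<lambda>(a, b). ?h a b)"
    unfolding case_prod_beta
    by (intro continuous_intros continuous_on_compose2[OF continuous_components(1)[of UNIV]]
        continuous_on_compose2[OF continuous_components(2)[of UNIV]]) auto
  have f0: "continuous_on UNIV (\<lambda>_::real. - 2 * c')" and h0: "continuous_on UNIV (\<lambda>(a::real, b::real). 0::real)"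
    by (auto simp: case_prod_beta)
  define F where "F \<delta> = sheared_box (\<lambda>_. - 2 * c') (\<lambda>_ _. 0) (2 * c - \<delta>) (2 * c + \<delta>) (B * \<delta>) (B * \<delta>\<^sup>2)" for \<delta>
  have K: "compact (F 1)" unfolding F_def by (rule compact_sheared_box[OF f0 h0])
  define C0 where "C0 = (2 * pi) ^ 3 + 2 * (2 * pi)\<^sup>2 * sqrt pi"
  have C0: "C0 > 0" by (simp add: C0_def add_pos_pos)
  define E where "E \<delta> = sheared_box ?f ?h (l + d + 2 * c) (u - d + 2 * c) \<delta> (\<delta>\<^sup>2)" for \<delta>
  have F: "F \<delta> \<in> sets borel" "emeasure lborel (F \<delta>) = ennreal (8 * B\<^sup>2 * \<delta> ^ 4)" "F \<delta> \<subseteq> F 1"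
    if \<delta>: "0 < \<delta>" "\<delta> \<le> 1" for \<delta>
  proof -
    show "F \<delta> \<in> sets borel" "emeasure lborel (F \<delta>) = ennreal (8 * B\<^sup>2 * \<delta> ^ 4)"
      using emeasure_sheared_box[OF f0 h0, of "2 * c - \<delta>" "2 * c + \<delta>" "B * \<delta>" "B * \<delta>\<^sup>2"] \<delta> B
      by (simp_all add: F_def power2_eq_square power4_eq_xxxx mult_ac)
    show "F \<delta> \<subseteq> F 1"
    proof
      fix x assume "x \<in> F \<delta>"
      moreover have "B * \<delta> \<le> B * 1" "B * \<delta>\<^sup>2 \<le> B * 1\<^sup>2"
        using \<delta> B by (auto intro!: mult_left_mono power_le_one)
      ultimately show "x \<in> F 1" using \<delta>(2) by (auto simp: F_def sheared_box_def)
    qed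
  qed
  have E: "E \<delta> \<in> sets borel" "emeasure lborel (E \<delta>) = ennreal (8 * d * \<delta> ^ 3)" "compact (E \<delta>)"
    if \<delta>: "0 < \<delta>" for \<delta>
  proof -
    show "E \<delta> \<in> sets borel" "emeasure lborel (E \<delta>) = ennreal (8 * d * \<delta> ^ 3)"
      using emeasure_sheared_box[OF fc hc, of "l + d + 2 * c" "u - d + 2 * c" \<delta> "\<delta>\<^sup>2"] \<delta> d
      by (simp_all add: E_def power2_eq_square power3_eq_cube mult_ac d_def field_simps)
    show "compact (E \<delta>)" unfolding E_def by (rule compact_sheared_box[OF fc hc])
  qed
  have average: "\<exists>v E'. v \<in> borel_measurable borel \<and> (\<forall>x. 0 \<le> v x \<and> v x \<le> measure \<mu> UNIV) \<and>
      (\<forall>x. heis_average \<gamma> \<mu> (\<lambda>x. of_real (indicator (F \<delta>) x)) x = of_real (v x)) \<and>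
      open E' \<and> E \<delta> \<subseteq> E' \<and> (\<forall>x\<in>E'. m * \<delta> ^ 1 \<le> v x)"
    if \<delta>: "0 < \<delta>" "\<delta> \<le> 1" "\<delta> \<le> 2 * d" for \<delta>
  proof -
    define E' where "E' = {x::real^3. x$1 \<in> {l + 2 * c<..<u + 2 * c} \<and> \<bar>x$2 - ?f (x$1)\<bar> < 2 * \<delta>
        \<and> \<bar>x$3 - ?h (x$1) (x$2)\<bar> < 2 * \<delta>\<^sup>2}"
    obtain v where v: "v \<in> borel_measurable borel" "\<And>x. 0 \<le> v x" "\<And>x. v x \<le> measure \<mu> UNIV"
      "\<And>x. heis_average \<gamma> \<mu> (\<lambda>x. of_real (indicator (F \<delta>) x)) x = of_real (v x)"
      and v_lower: "\<And>x a b m. a \<le> b \<Longrightarrow> m \<ge> 0 \<Longrightarrow> (\<And>t. t \<in> {a..b} \<Longrightarrow> m \<le> \<eta> t) \<Longrightarrow>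
        (\<And>t. t \<in> {a..b} \<Longrightarrow> heis_inv (\<gamma> t) \<odot> x \<in> F \<delta>) \<Longrightarrow> m * (b - a) \<le> v x"
      by (rule heis_average_indicator[OF density \<mu> curve_measurable F(1)[OF \<delta>(1,2)]]) blast
    have inF: "heis_inv (\<gamma> t') \<odot> x \<in> F \<delta>"
      if x: "x \<in> E'" and t': "t' \<in> {l..u}" "\<bar>t' - (x$1 - 2 * c)\<bar> \<le> \<delta>" for x t'
    proof -
      define t where "t = x$1 - 2 * c"
      define e where "e = x$2 - (\<gamma>\<^sub>2 t - 2 * c')"
      define k where "k \<tau> = x$3 - \<gamma>\<^sub>3 \<tau> + (\<gamma>\<^sub>2 \<tau> * x$1 - \<tau> * x$2) / 2" for \<tau>
      have t: "t \<in> {l..u}" and e: "\<bar>e\<bar> \<le> 2 * \<delta>" and kt: "\<bar>k t\<bar> \<le> 2 * \<delta>\<^sup>2"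
        using x by (auto simp: E'_def t_def e_def k_def algebra_simps)
      have tt': "\<bar>t' - t\<bar> \<le> \<delta>" using t' by (simp add: t_def)
      \<comment> \<open>\<open>k \<tau>\<close> is the third coordinate of \<open>\<gamma>(\<tau>)\<^sup>-\<^sup>1 \<odot> x\<close>; in its derivative the terms of size 1 cancel\<close>
      have k': "(k has_real_derivative (deriv \<gamma>\<^sub>2 \<tau> * (t - \<tau>) + (\<gamma>\<^sub>2 \<tau> - \<gamma>\<^sub>2 t) - e) / 2) (at \<tau>)"
        if "\<tau> \<in> {l..u}" for \<tau>
      proof -
        have "\<tau> \<in> {0..1}" using that lu by auto
        note eq = contact[OF this]
        have x1: "x$1 = t + 2 * c" and x2: "x$2 = \<gamma>\<^sub>2 t - 2 * c' + e"
          by (simp_all add: t_def e_def)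
        have "(k has_real_derivative - deriv \<gamma>\<^sub>3 \<tau> + (deriv \<gamma>\<^sub>2 \<tau> * x$1 - x$2) / 2) (at \<tau>)"
          unfolding k_def[abs_def]
          by (auto intro!: derivative_eq_intros smooth_real_derivative[OF smooth(1), of 0, simplified]
              smooth_real_derivative[OF smooth(2), of 0, simplified])
        then show ?thesis
          by (rule DERIV_cong) (simp add: eq x1 x2 field_simps)
      qed
      have bound: "\<bar>(deriv \<gamma>\<^sub>2 \<tau> * (t - \<tau>) + (\<gamma>\<^sub>2 \<tau> - \<gamma>\<^sub>2 t) - e) / 2\<bar> \<le> (L + 1) * \<delta>"
        if \<tau>: "\<tau> \<in> closed_segment t t'" for \<tau>
      proof -
        have \<tau>1: "\<tau> \<in> {0..1}" "t \<in> {0..1}" and \<tau>2: "\<bar>\<tau> - t\<bar> \<le> \<delta>"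
          using \<tau> t t' tt' lu by (auto simp: closed_segment_eq_real_ivl split: if_splits)
        have "\<bar>deriv \<gamma>\<^sub>2 \<tau> * (t - \<tau>)\<bar> \<le> L * \<delta>"
          unfolding abs_mult using L(2)[OF \<tau>1(1)] \<tau>2 L(1) by (intro mult_mono) auto
        moreover have "\<bar>\<gamma>\<^sub>2 \<tau> - \<gamma>\<^sub>2 t\<bar> \<le> L * \<delta>"
          using L(3)[OF \<tau>1] mult_left_mono[OF \<tau>2 L(1)] by linarith
        ultimately show ?thesis using e by (simp add: algebra_simps abs_le_iff)
      qed
      have "norm (k t' - k t) \<le> ((L + 1) * \<delta>) * norm (t' - t)"
      proof (rule field_differentiable_bound[of "closed_segment t t'" k])
        fix \<tau> assume \<tau>: "\<tau> \<in> closed_segment t t'"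
        then have "\<tau> \<in> {l..u}" using t t' by (auto simp: closed_segment_eq_real_ivl split: if_splits)
        then show "(k has_field_derivative (deriv \<gamma>\<^sub>2 \<tau> * (t - \<tau>) + (\<gamma>\<^sub>2 \<tau> - \<gamma>\<^sub>2 t) - e) / 2) (at \<tau> within closed_segment t t')"
          using k' has_field_derivative_at_within by blast
        show "norm ((deriv \<gamma>\<^sub>2 \<tau> * (t - \<tau>) + (\<gamma>\<^sub>2 \<tau> - \<gamma>\<^sub>2 t) - e) / 2) \<le> (L + 1) * \<delta>"
          using bound[OF \<tau>] by simp
      qed auto
      also have "\<dots> \<le> ((L + 1) * \<delta>) * \<delta>"
        using tt' L(1) \<delta> by (intro mult_left_mono) auto
      finally have "\<bar>k t' - k t\<bar> \<le> (L + 1) * \<delta>\<^sup>2" by (simp add: power2_eq_square mult_ac)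
      then have k3: "\<bar>k t'\<bar> \<le> B * \<delta>\<^sup>2"
        using kt by (simp add: B_def algebra_simps abs_le_iff)
      have "\<bar>\<gamma>\<^sub>2 t - \<gamma>\<^sub>2 t'\<bar> \<le> L * \<delta>"
        using L(3)[of t t'] mult_left_mono[OF tt' L(1)] t t' lu by (auto simp: abs_minus_commute)
      then have "\<bar>e + (\<gamma>\<^sub>2 t - \<gamma>\<^sub>2 t')\<bar> \<le> 2 * \<delta> + L * \<delta>" using e by linarith
      also have "\<dots> \<le> B * \<delta>" using \<delta> by (simp add: B_def algebra_simps)
      finally have k2: "\<bar>x$2 - \<gamma>\<^sub>2 t' + 2 * c'\<bar> \<le> B * \<delta>" by (simp add: e_def algebra_simps)
      show ?thesis
        unfolding F_def sheared_box_def mem_Collect_eq translate_components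
        using k2 k3 tt' by (auto simp: t_def k_def abs_le_iff algebra_simps)
    qed
    have "open E'" unfolding E'_def by (rule open_sheared_box[OF fc hc])
    moreover have "E \<delta> \<subseteq> E'"
    proof
      fix x assume "x \<in> E \<delta>"
      then have "l + d + 2 * c \<le> x$1" "x$1 \<le> u - d + 2 * c"
        "\<bar>x$2 - ?f (x$1)\<bar> \<le> \<delta>" "\<bar>x$3 - ?h (x$1) (x$2)\<bar> \<le> \<delta>\<^sup>2"
        by (simp_all add: E_def sheared_box_def)
      moreover have "\<delta> < 2 * \<delta>" "\<delta>\<^sup>2 < 2 * \<delta>\<^sup>2" using \<delta> by simp_all
      ultimately show "x \<in> E'"
        unfolding E'_def mem_Collect_eq greaterThanLessThan_iff using d by linarith
    qed
    moreover have "m * \<delta> \<le> v x" if x: "x \<in> E'" for x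
    proof -
      define t where "t = x$1 - 2 * c"
      have t: "l < t" "t < u" using x by (auto simp: E'_def t_def)
      \<comment> \<open>one of the intervals \<open>{t - \<delta>..t}\<close> and \<open>{t..t + \<delta>}\<close> stays inside \<open>{l..u}\<close>, as \<open>2 \<delta> \<le> u - l\<close>\<close>
      show ?thesis
      proof (cases "l \<le> t - \<delta>")
        case True
        have "m * (t - (t - \<delta>)) \<le> v x"
          using True t \<delta> lu m by (intro v_lower inF[OF x]) (auto simp: t_def)
        then show ?thesis by simp
      next
        case False
        have "t + \<delta> \<le> u" using False \<delta> by (simp add: d_def field_simps)
        then have "m * ((t + \<delta>) - t) \<le> v x"
          using t \<delta> lu m by (intro v_lower inF[OF x]) (auto simp: t_def)
        then show ?thesis by simp
      qed
    qed
    ultimately show ?thesis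
      using v by (intro exI[of _ v] exI[of _ E'] conjI allI ballI) simp_all
  qed
  have heat: "(\<integral>\<^sup>+y\<in>E \<delta>. gauss_kernel r (x - y) \<partial>lborel) \<le> ennreal (C0 * (\<delta> ^ 4 / r) powr b)"
    if \<delta>: "0 < \<delta>" and r: "0 < r" for \<delta> r x
    unfolding C0_def
  proof (rule min_le_powr_interpolation[where a = "1 / 2"])
    show "(\<integral>\<^sup>+y\<in>E \<delta>. gauss_kernel r (x - y) \<partial>lborel) \<le> ennreal ((2 * pi) ^ 3)"
      using nn_integral_gauss_kernel_le[OF r, of x "E \<delta>"] by simp
    have slice: "emeasure lborel {z. vector [a, b, z] \<in> E \<delta>} \<le> ennreal (2 * \<delta>\<^sup>2)" for a b
    proof -
      have "emeasure lborel {z. vector [a, b, z] \<in> E \<delta>} \<le> emeasure lborel {?h a b - \<delta>\<^sup>2..?h a b + \<delta>\<^sup>2}"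
        by (intro emeasure_mono) (auto simp: E_def sheared_box_def abs_le_iff)
      also have "\<dots> = ennreal (2 * \<delta>\<^sup>2)" by simp
      finally show ?thesis .
    qed
    have "(\<integral>\<^sup>+y\<in>E \<delta>. gauss_kernel r (x - y) \<partial>lborel) \<le> ennreal ((2 * pi)\<^sup>2 * sqrt (pi / r) * (2 * \<delta>\<^sup>2))"
      by (rule nn_integral_gauss_kernel_le_section[OF r E(1)[OF \<delta>] _ slice]) simp
    also have "(2 * pi)\<^sup>2 * sqrt (pi / r) * (2 * \<delta>\<^sup>2) = 2 * (2 * pi)\<^sup>2 * sqrt pi * (\<delta> ^ 4 / r) powr (1 / 2)"
    proof -
      have "(\<delta> ^ 4 / r) powr (1 / 2) = sqrt ((\<delta>\<^sup>2)\<^sup>2 / r)"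
        using r \<delta> by (simp add: powr_half_sqrt)
      also have "\<dots> = \<delta>\<^sup>2 / sqrt r"
        unfolding real_sqrt_divide real_sqrt_abs by simp
      finally show ?thesis by (simp add: real_sqrt_divide)
    qed
    finally show "(\<integral>\<^sup>+y\<in>E \<delta>. gauss_kernel r (x - y) \<partial>lborel) \<le> ennreal (2 * (2 * pi)\<^sup>2 * sqrt pi * (\<delta> ^ 4 / r) powr (1 / 2))" .
  qed (use r \<delta> b in auto)
  have "real 4 + real 4 * b \<le> p * real 1 + real 3"
  proof (rule test_family_exponents[OF bdd K p s b(1,2), where \<delta>\<^sub>0 = "min 1 (2 * d)" and F = F and E = E
          and w = "8 * B\<^sup>2" and e = "8 * d" and \<alpha> = m and C\<^sub>0 = C0 and M = "measure \<mu> UNIV"])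
    fix \<delta> :: real assume \<delta>: "0 < \<delta>" "\<delta> \<le> min 1 (2 * d)"
    show "F \<delta> \<in> sets borel \<and> F \<delta> \<subseteq> F 1 \<and> emeasure lborel (F \<delta>) \<le> ennreal (8 * B\<^sup>2 * \<delta> ^ 4)"
      using F[of \<delta>] \<delta> by simp
    show "compact (E \<delta>) \<and> measure lborel (E \<delta>) = 8 * d * \<delta> ^ 3"
      using E[OF \<delta>(1)] \<delta>(1) d by (simp add: measure_def)
    show "\<exists>v E'. v \<in> borel_measurable borel \<and> (\<forall>x. 0 \<le> v x \<and> v x \<le> measure \<mu> UNIV) \<and>
        (\<forall>x. heis_average \<gamma> \<mu> (\<lambda>x. of_real (indicator (F \<delta>) x)) x = of_real (v x)) \<and>
        open E' \<and> E \<delta> \<subseteq> E' \<and> (\<forall>x\<in>E'. m * \<delta> ^ 1 \<le> v x)"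
      using \<delta> by (intro average) auto
  qed (use heat lu d B C0 in simp_all)
  then show ?thesis by simp
qed

end

section \<open>The bound on the order of smoothing\<close>

theorem proposition1p1:
  fixes \<gamma> :: "real \<Rightarrow> real^3" and \<gamma>\<^sub>2 \<gamma>\<^sub>3 \<eta> :: "real \<Rightarrow> real"
    and \<mu> :: "real measure" and p s :: real
  assumes "\<And>t. \<gamma> t = vector [t, \<gamma>\<^sub>2 t, \<gamma>\<^sub>3 t]"
    and "smooth_real \<gamma>\<^sub>2" and "smooth_real \<gamma>\<^sub>3"
    and "\<And>t. t \<in> {0..1} \<Longrightarrow> (deriv ^^ 2) \<gamma>\<^sub>2 t \<noteq> 0"
    and "\<And>t. t \<in> {0..1} \<Longrightarrow>
           det (vector [vector [(deriv ^^ 2) \<gamma>\<^sub>2 t, (deriv ^^ 2) \<gamma>\<^sub>3 t],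
                        vector [(deriv ^^ 3) \<gamma>\<^sub>2 t, (deriv ^^ 3) \<gamma>\<^sub>3 t]] :: real^2^2)
           = 1/2 * ((deriv ^^ 2) \<gamma>\<^sub>2 t)\<^sup>2"
    and "smooth_real \<eta>" and "\<And>t. \<eta> t \<ge> 0" and "closure {t. \<eta> t \<noteq> 0} \<subseteq> {0..1}"
    and "\<mu> = density lborel (\<lambda>t. ennreal (\<eta> t))" and "\<mu> \<noteq> null_measure lborel"
    and "1 < p"
    and "bounded_Lp_comp_to_sobolev p s (heis_average \<gamma> \<mu>)"
  shows "s \<le> min (1 / p) (1/2 * (1 - 1 / p))"
proof -
  note p = \<open>1 < p\<close> and bdd = assms(12)
  interpret curve_average \<gamma> \<gamma>\<^sub>2 \<gamma>\<^sub>3 \<eta> \<mu>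
  proof
    show "continuous_on UNIV \<eta>" using smooth_real_continuous[OF assms(6), of UNIV 0] by simp
  qed (fact assms)+
  have det: "(deriv ^^ 2) \<gamma>\<^sub>2 t * (deriv ^^ 3) \<gamma>\<^sub>3 t - (deriv ^^ 2) \<gamma>\<^sub>3 t * (deriv ^^ 3) \<gamma>\<^sub>2 t
      = 1/2 * ((deriv ^^ 2) \<gamma>\<^sub>2 t)\<^sup>2" if "t \<in> {0..1}" for t
    using assms(5)[OF that] by (simp only: det_2 vector_2)
  obtain c c' where contact: "\<forall>t\<in>{0..1}. deriv \<gamma>\<^sub>3 t = (t / 2 + c) * deriv \<gamma>\<^sub>2 t - \<gamma>\<^sub>2 t / 2 + c'"
    by (rule contact_constants[OF assms(2,3,4) det])
  have first: "s \<le> 1 / p"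
  proof (rule ccontr)
    assume "\<not> s \<le> 1 / p"
    then have "p * s > 1" "s > 1 / p" using p by (simp_all add: field_simps)
    moreover have "0 < 1 / p" using p by simp
    then have "s > 0" using \<open>s > 1 / p\<close> by linarith
    \<comment> \<open>a number between \<open>1/2\<close> and \<open>p * s / 2\<close> that does not exceed \<open>3/2\<close>\<close>
    ultimately have "min (3 / 2) ((1 + p * s) / 4) \<le> 1 / 2"
      using p by (intro curve_neighbourhood_exponent_bound[OF bdd p]) (auto simp: min_def)
    then show False using \<open>p * s > 1\<close> by (simp add: min_def split: if_splits)
  qed
  have "s \<le> 1/2 * (1 - 1 / p)"
  proof (rule ccontr)
    assume "\<not> s \<le> 1/2 * (1 - 1 / p)"
    then have ps: "p * s > (p - 1) / 2" using p by (simp add: field_simps)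
    have ps': "p * s \<le> 1" using first p by (simp add: field_simps)
    have "0 < p * s" using ps p by simp
    then have s: "s > 0" using p by (simp add: zero_less_mult_iff)
    \<comment> \<open>the midpoint between \<open>(p - 1) / 4\<close> and \<open>p * s / 2\<close>\<close>
    define b where "b = (p - 1 + 2 * (p * s)) / 8"
    have "0 \<le> b" "b < p * s / 2" "b \<le> 1 / 2"
      using p ps ps' by (simp_all add: b_def field_simps)
    then have "4 * b \<le> p - 1"
      by (rule horizontal_tube_exponent_bound[OF bdd p s _ _ _ contact[THEN bspec]])
    then show False using ps by (simp add: b_def field_simps)
  qed
  with first show ?thesis by simp
qed

end
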